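(* Let $\mathbb{F}$ be a field of characteristic zero and let $\boxtimes$ be the tetrahedron Lie algebra over $\mathbb{F}$. For mutually distinct $h,i,j,k\in\mathbb{I}=\{0,1,2,3\}$, the vector space $\boxtimes$ satisfies $$\boxtimes = X_{kh}+X_{hi}+X_{ij}\qquad\text{(direct sum)},$$ where $X_{rs}$ denotes the subspace of $x_{rs}$-like elements of $\boxtimes$.
   Context: $\mathbb{I}=\{0,1,2,3\}$. The tetrahedron algebra $\boxtimes$ is the Lie algebra over $\mathbb{F}$ with generators $\{x_{ij}\mid i,j\in\mathbb{I},\ i\neq j\}$ (the standard generators) and relations: (i) $x_{ij}+x_{ji}=0$ for distinct $i,j\in\mathbb{I}$; (ii) $[x_{ij},x_{jk}]=2x_{ij}+2x_{jk}$ for mutually distinct $i,j,k\in\mathbb{I}$; (iii) $[x_{ij},[x_{ij},[x_{ij},x_{kh}]]]=4[x_{ij},x_{kh}]$ for mutually distinct $h,i,j,k\in\mathbb{I}$. For distinct $i,j\in\mathbb{I}$, an element $\xi\in\boxtimes$ is called $x_{ij}$-like if $[x_{ij},\xi]=0$ and $[x_{kh},[x_{kh},[x_{kh},\xi]]]=4[x_{kh},\xi]$, where $h,i,j,k$ are mutually distinct elements of $\mathbb{I}$. $X_{ij}$ is the set of all $x_{ij}$-like elements of $\boxtimes$; it is a subspace of $\boxtimes$ and $X_{ij}=X_{ji}$. *)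

theory Defs
  imports Complex_Main "HOL-Library.Numeral_Type"
begin

section \<open>Lie algebras and direct sums of subspaces\<close>

locale lie_algebra = vector_space scale
  for scale :: "'f::field \<Rightarrow> 'v::ab_group_add \<Rightarrow> 'v" +
  fixes bracket :: "'v \<Rightarrow> 'v \<Rightarrow> 'v"
  assumes bracket_add_left: "bracket (a + b) c = bracket a c + bracket b c"
    and bracket_add_right: "bracket a (b + c) = bracket a b + bracket a c"
    and bracket_scale_left: "bracket (scale r a) b = scale r (bracket a b)"
    and bracket_scale_right: "bracket a (scale r b) = scale r (bracket a b)"
    and bracket_self: "bracket a a = 0"
    and jacobi: "bracket a (bracket b c) + bracket b (bracket c a) + bracket c (bracket a b) = 0"

text \<open>
  \<open>V\<close> is the internal direct sum of the subspaces listed in \<open>Us\<close>: the elements of \<open>V\<close> are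
  exactly the sums with one summand from each member of \<open>Us\<close>, and the summands are unique.
\<close>

definition (in vector_space) direct_sum_of :: "'b set \<Rightarrow> 'b set list \<Rightarrow> bool" where
  "direct_sum_of V Us \<longleftrightarrow>
     (\<forall>U\<in>set Us. subspace U) \<and> bij_betw sum_list (listset Us) V"


section \<open>Lie algebras given by generators and relations\<close>

text \<open>
  The Lie algebra presented by generators \<open>'g\<close> and relations \<open>R\<close> is the set of formal Lie
  expressions modulo the least congruence that contains \<open>R\<close> and satisfies the vector space and
  Lie algebra axioms.
\<close>

datatype ('f, 'g) lie_term =
    Gen 'g
  | Zero
  | Add "('f, 'g) lie_term" "('f, 'g) lie_term"
  | Scale 'f "('f, 'g) lie_term"
  | Bracket "('f, 'g) lie_term" "('f, 'g) lie_term"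

inductive lie_cong ::
  "(('f::field, 'g) lie_term \<Rightarrow> ('f, 'g) lie_term \<Rightarrow> bool) \<Rightarrow>
   ('f, 'g) lie_term \<Rightarrow> ('f, 'g) lie_term \<Rightarrow> bool" for R
where
  rel: "R s t \<Longrightarrow> lie_cong R s t"
| refl: "lie_cong R s s"
| sym: "lie_cong R s t \<Longrightarrow> lie_cong R t s"
| trans: "lie_cong R s t \<Longrightarrow> lie_cong R t u \<Longrightarrow> lie_cong R s u"
| Add: "lie_cong R s s' \<Longrightarrow> lie_cong R t t' \<Longrightarrow> lie_cong R (Add s t) (Add s' t')"
| Scale: "lie_cong R s s' \<Longrightarrow> lie_cong R (Scale c s) (Scale c s')"
| Bracket: "lie_cong R s s' \<Longrightarrow> lie_cong R t t' \<Longrightarrow> lie_cong R (Bracket s t) (Bracket s' t')"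
| add_assoc: "lie_cong R (Add (Add s t) u) (Add s (Add t u))"
| add_comm: "lie_cong R (Add s t) (Add t s)"
| add_zero: "lie_cong R (Add Zero s) s"
| add_neg: "lie_cong R (Add (Scale (- 1) s) s) Zero"
| scale_add: "lie_cong R (Scale c (Add s t)) (Add (Scale c s) (Scale c t))"
| add_scale: "lie_cong R (Scale (c + d) s) (Add (Scale c s) (Scale d s))"
| scale_scale: "lie_cong R (Scale c (Scale d s)) (Scale (c * d) s)"
| scale_one: "lie_cong R (Scale 1 s) s"
| bracket_add_left: "lie_cong R (Bracket (Add s t) u) (Add (Bracket s u) (Bracket t u))"
| bracket_add_right: "lie_cong R (Bracket s (Add t u)) (Add (Bracket s t) (Bracket s u))"
| bracket_scale_left: "lie_cong R (Bracket (Scale c s) t) (Scale c (Bracket s t))"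
| bracket_scale_right: "lie_cong R (Bracket s (Scale c t)) (Scale c (Bracket s t))"
| bracket_self: "lie_cong R (Bracket s s) Zero"
| jacobi: "lie_cong R (Add (Add (Bracket s (Bracket t u)) (Bracket t (Bracket u s)))
                           (Bracket u (Bracket s t))) Zero"

lemma equivp_lie_cong: "equivp (lie_cong R)"
  by (rule equivpI)
     (auto intro!: reflpI sympI transpI intro: lie_cong.refl lie_cong.sym lie_cong.trans)


section \<open>The tetrahedron algebra\<close>

text \<open>The index set \<open>{0,1,2,3}\<close> is the four-element type \<open>4\<close>; its arithmetic is not used.\<close>

lemma UNIV_index: "(UNIV :: 4 set) = {0, 1, 2, 3}"
proof -
  have "card {0, 1, 2, 3 :: 4} = CARD(4)"
    by simp
  then show ?thesis
    by (metis card_subset_eq finite_class.finite_UNIV subset_UNIV)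
qed

typedef tet_gen = "{p :: 4 \<times> 4. fst p \<noteq> snd p}"
  by (rule exI[of _ "(0, 1)"]) simp

abbreviation gen :: "4 \<Rightarrow> 4 \<Rightarrow> ('f, tet_gen) lie_term" where
  "gen i j \<equiv> Gen (Abs_tet_gen (i, j))"

inductive tet_rel ::
  "('f::field, tet_gen) lie_term \<Rightarrow> ('f, tet_gen) lie_term \<Rightarrow> bool"
where
  rel_i: "i \<noteq> j \<Longrightarrow> tet_rel (Add (gen i j) (gen j i)) Zero"
| rel_ii: "distinct [i, j, k] \<Longrightarrow>
    tet_rel (Bracket (gen i j) (gen j k)) (Add (Scale 2 (gen i j)) (Scale 2 (gen j k)))"
| rel_iii: "distinct [h, i, j, k] \<Longrightarrow>
    tet_rel (Bracket (gen i j) (Bracket (gen i j) (Bracket (gen i j) (gen k h))))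
            (Scale 4 (Bracket (gen i j) (gen k h)))"

quotient_type (overloaded) 'f tet = "('f::field, tet_gen) lie_term" / "lie_cong tet_rel"
  by (rule equivp_lie_cong)

instantiation tet :: (field) ab_group_add
begin

lift_definition zero_tet :: "'a tet" is Zero .

lift_definition plus_tet :: "'a tet \<Rightarrow> 'a tet \<Rightarrow> 'a tet" is Add
  by (rule lie_cong.Add)

lift_definition uminus_tet :: "'a tet \<Rightarrow> 'a tet" is "Scale (- 1)"
  by (rule lie_cong.Scale)

definition minus_tet :: "'a tet \<Rightarrow> 'a tet \<Rightarrow> 'a tet" where
  "minus_tet a b = a + - b"

instance
proof
  fix a b c :: "'a tet"
  show "a + b + c = a + (b + c)" by transfer (rule lie_cong.add_assoc)
  show "a + b = b + a" by transfer (rule lie_cong.add_comm)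
  show "0 + a = a" by transfer (rule lie_cong.add_zero)
  show "- a + a = 0" by transfer (rule lie_cong.add_neg)
  show "a - b = a + - b" by (rule minus_tet_def)
qed

end

lift_definition tet_scale :: "'f::field \<Rightarrow> 'f tet \<Rightarrow> 'f tet" is Scale
  by (rule lie_cong.Scale)

lift_definition tet_bracket :: "'f::field tet \<Rightarrow> 'f tet \<Rightarrow> 'f tet" is Bracket
  by (rule lie_cong.Bracket)

text \<open>The standard generators; the value at \<open>i = j\<close> is irrelevant.\<close>

lift_definition tet_x :: "4 \<Rightarrow> 4 \<Rightarrow> 'f::field tet" is gen .

global_interpretation tet: lie_algebra "tet_scale :: 'f::field \<Rightarrow> _" tet_bracket
proof
  fix a b c :: "'f tet" and r s :: 'f
  show "tet_scale r (a + b) = tet_scale r a + tet_scale r b"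
    by transfer (rule lie_cong.scale_add)
  show "tet_scale (r + s) a = tet_scale r a + tet_scale s a"
    by transfer (rule lie_cong.add_scale)
  show "tet_scale r (tet_scale s a) = tet_scale (r * s) a"
    by transfer (rule lie_cong.scale_scale)
  show "tet_scale 1 a = a"
    by transfer (rule lie_cong.scale_one)
  show "tet_bracket (a + b) c = tet_bracket a c + tet_bracket b c"
    by transfer (rule lie_cong.bracket_add_left)
  show "tet_bracket a (b + c) = tet_bracket a b + tet_bracket a c"
    by transfer (rule lie_cong.bracket_add_right)
  show "tet_bracket (tet_scale r a) b = tet_scale r (tet_bracket a b)"
    by transfer (rule lie_cong.bracket_scale_left)
  show "tet_bracket a (tet_scale r b) = tet_scale r (tet_bracket a b)"
    by transfer (rule lie_cong.bracket_scale_right)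
  show "tet_bracket a a = 0"
    by transfer (rule lie_cong.bracket_self)
  show "tet_bracket a (tet_bracket b c) + tet_bracket b (tet_bracket c a)
      + tet_bracket c (tet_bracket a b) = 0"
    by transfer (rule lie_cong.jacobi)
qed

text \<open>
  The generators satisfy the defining relations, and the tetrahedron algebra is universal with
  this property.
\<close>

lemma tet_x_rel_i: "i \<noteq> j \<Longrightarrow> tet_x i j + tet_x j i = 0"
  by transfer (intro lie_cong.rel rel_i)

lemma tet_x_rel_ii:
  "distinct [i, j, k] \<Longrightarrow>
     tet_bracket (tet_x i j) (tet_x j k) = tet_scale 2 (tet_x i j) + tet_scale 2 (tet_x j k)"
  by transfer (intro lie_cong.rel rel_ii)

lemma tet_x_rel_iii:
  "distinct [h, i, j, k] \<Longrightarrow>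
     tet_bracket (tet_x i j) (tet_bracket (tet_x i j) (tet_bracket (tet_x i j) (tet_x k h)))
       = tet_scale 4 (tet_bracket (tet_x i j) (tet_x k h))"
  by transfer (intro lie_cong.rel rel_iii)

primrec (in lie_algebra) eval_term :: "('g \<Rightarrow> 'v) \<Rightarrow> ('f, 'g) lie_term \<Rightarrow> 'v" where
  "eval_term \<phi> (Gen g) = \<phi> g"
| "eval_term \<phi> Zero = 0"
| "eval_term \<phi> (Add s t) = eval_term \<phi> s + eval_term \<phi> t"
| "eval_term \<phi> (Scale c s) = scale c (eval_term \<phi> s)"
| "eval_term \<phi> (Bracket s t) = bracket (eval_term \<phi> s) (eval_term \<phi> t)"

lemma (in lie_algebra) eval_term_cong:
  assumes "lie_cong R s t" and "\<And>s t. R s t \<Longrightarrow> eval_term \<phi> s = eval_term \<phi> t"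
  shows "eval_term \<phi> s = eval_term \<phi> t"
  using assms(1)
  by induction
     (simp_all add: assms(2) algebra_simps bracket_add_left bracket_add_right bracket_scale_left
       bracket_scale_right bracket_self jacobi[unfolded add.assoc])

theorem (in lie_algebra) tet_universal:
  assumes i: "\<And>i j. i \<noteq> j \<Longrightarrow> y i j + y j i = 0"
    and ii: "\<And>i j k. distinct [i, j, k] \<Longrightarrow>
      bracket (y i j) (y j k) = scale 2 (y i j) + scale 2 (y j k)"
    and iii: "\<And>h i j k. distinct [h, i, j, k] \<Longrightarrow>
      bracket (y i j) (bracket (y i j) (bracket (y i j) (y k h))) = scale 4 (bracket (y i j) (y k h))"
  shows "\<exists>!f :: 'f tet \<Rightarrow> 'v.
    (\<forall>a b. f (a + b) = f a + f b) \<and> (\<forall>c a. f (tet_scale c a) = scale c (f a)) \<and>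
    (\<forall>a b. f (tet_bracket a b) = bracket (f a) (f b)) \<and> (\<forall>i j. i \<noteq> j \<longrightarrow> f (tet_x i j) = y i j)"
proof -
  let ?hom = "\<lambda>f :: 'f tet \<Rightarrow> 'v.
    (\<forall>a b. f (a + b) = f a + f b) \<and> (\<forall>c a. f (tet_scale c a) = scale c (f a)) \<and>
    (\<forall>a b. f (tet_bracket a b) = bracket (f a) (f b)) \<and> (\<forall>i j. i \<noteq> j \<longrightarrow> f (tet_x i j) = y i j)"
  define \<phi> where "\<phi> g = (case Rep_tet_gen g of (i, j) \<Rightarrow> y i j)" for g
  define f where "f a = eval_term \<phi> (rep_tet a)" for a
  have gen: "\<phi> (Abs_tet_gen (i, j)) = y i j" if "i \<noteq> j" for i j
    using that by (simp add: \<phi>_def Abs_tet_gen_inverse)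
  have rel: "eval_term \<phi> s = eval_term \<phi> t" if "tet_rel s t" for s t :: "('f, tet_gen) lie_term"
    using that by cases (auto simp: gen i ii iii)
  have f_abs: "f (abs_tet s) = eval_term \<phi> s" for s
    unfolding f_def
    by (rule eval_term_cong[OF _ rel]) (rule rep_abs_rsp_left[OF Quotient3_tet lie_cong.refl])
  have hom_f: "?hom f"
  proof (intro conjI allI impI)
    fix a b :: "'f tet" and c :: 'f
    obtain s t where "a = abs_tet s" "b = abs_tet t"
      by (metis Quotient3_abs_rep[OF Quotient3_tet])
    then show "f (a + b) = f a + f b" "f (tet_scale c a) = scale c (f a)"
      "f (tet_bracket a b) = bracket (f a) (f b)"
      by (simp_all add: f_abs plus_tet.abs_eq tet_scale.abs_eq tet_bracket.abs_eq)
  qed (simp add: f_abs tet_x.abs_eq gen)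
  have uniq: "f1 = f2" if "?hom f1" "?hom f2" for f1 f2 :: "'f tet \<Rightarrow> 'v"
  proof
    have zero: "f1 0 = 0" "f2 0 = 0"
      using that by (metis add_cancel_right_right)+
    have "f1 (abs_tet s) = f2 (abs_tet s)" for s
    proof (induction s)
      case (Gen g)
      obtain i j where "i \<noteq> j" "g = Abs_tet_gen (i, j)"
        by (cases g) auto
      then show ?case
        using that by (simp flip: tet_x.abs_eq)
    next
      case Zero
      then show ?case
        using zero by (simp flip: zero_tet.abs_eq)
    qed (use that in \<open>simp_all flip: plus_tet.abs_eq tet_scale.abs_eq tet_bracket.abs_eq\<close>)
    then show "f1 a = f2 a" for a
      by (metis Quotient3_abs_rep[OF Quotient3_tet])
  qed
  show ?thesis
    by (rule ex1I[where P = ?hom, OF hom_f uniq[OF _ hom_f]])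
qed


section \<open>Elements that are like a standard generator\<close>

definition tet_x_like :: "4 \<Rightarrow> 4 \<Rightarrow> 'f::field tet \<Rightarrow> bool" where
  "tet_x_like i j \<xi> \<longleftrightarrow>
     tet_bracket (tet_x i j) \<xi> = 0 \<and>
     (\<forall>h k. distinct [h, i, j, k] \<longrightarrow>
        tet_bracket (tet_x k h) (tet_bracket (tet_x k h) (tet_bracket (tet_x k h) \<xi>))
          = tet_scale 4 (tet_bracket (tet_x k h) \<xi>))"

text \<open>The condition for \<open>h, k\<close> is the one for \<open>k, h\<close>, so checking one of the two orders suffices.\<close>

lemma tet_x_like_iff:
  assumes "distinct [h, i, j, k]"
  shows "tet_x_like i j \<xi> \<longleftrightarrow>
     tet_bracket (tet_x i j) \<xi> = 0 \<and>
     tet_bracket (tet_x k h) (tet_bracket (tet_x k h) (tet_bracket (tet_x k h) \<xi>))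
       = tet_scale 4 (tet_bracket (tet_x k h) \<xi>)"
proof -
  have zero_l: "tet_bracket 0 b = 0" for b :: "'a tet"
    by (metis tet.bracket_add_left add_cancel_right_right)
  have zero_r: "tet_bracket b 0 = 0" for b :: "'a tet"
    by (metis tet.bracket_add_right add_cancel_right_right)
  have minus_l: "tet_bracket (- a) b = - tet_bracket a b" for a b :: "'a tet"
    by (metis tet.bracket_add_left zero_l add.right_inverse minus_unique)
  have minus_r: "tet_bracket a (- b) = - tet_bracket a b" for a b :: "'a tet"
    by (metis tet.bracket_add_right zero_r add.right_inverse minus_unique)
  have hk: "tet_x h k = - (tet_x k h :: 'a tet)"
    using tet_x_rel_i[of h k] assms by (simp add: eq_neg_iff_add_eq_0)
  have all: "a \<in> {h, i, j, k}" for a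
  proof -
    have "card {h, i, j, k} = CARD(4)"
      using assms by auto
    then show ?thesis
      by (metis card_subset_eq finite_class.finite_UNIV subset_UNIV UNIV_I)
  qed
  have pairs: "distinct [a, i, j, b] \<longleftrightarrow> (a = h \<and> b = k) \<or> (a = k \<and> b = h)" for a b
    using all[of a] all[of b] assms by auto
  show ?thesis
    unfolding tet_x_like_def pairs by (auto simp: hk minus_l minus_r)
qed

definition tet_X :: "4 \<Rightarrow> 4 \<Rightarrow> 'f::field tet set" where
  "tet_X i j = {\<xi>. tet_x_like i j \<xi>}"

lemma subspace_tet_X: "tet.subspace (tet_X i j)"
proof -
  have zero: "tet_bracket a 0 = 0" for a :: "'a tet"
    by (metis tet.bracket_add_right add_cancel_right_right)
  show ?thesis
    by (rule tet.subspaceI)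
       (auto simp: tet_X_def tet_x_like_def zero tet.bracket_add_right tet.bracket_scale_right
         tet.scale_right_distrib mult.commute)
qed

end

(*
  Fix a path a, b, c, d through the index set. The elements x_ab, x_bc, x_ca span a copy of sl_2, and
  each x_di differs from an element of it by a highest weight vector that generates an adjoint
  module; so there are maps u |-> u (x) t, u (x) t', u (x) t'' from sl_2 into the algebra, and
  relation (iii) provides the Serre relation from which all powers of t arise. Relation (ii) says
  t t' = t - 1, t' t'' = t' - 1, t'' t = t'' - 1. Hence the elements u (x) t^n, u (x) t'^n,
  u (x) t''^n span a subspace that contains the generators and is stable under them, i.e. everything.
  Evaluating t at a scalar s other than 0, 1 with t' = 1 - 1/s, t'' = 1/(1 - s) gives homomorphisms
  onto sl_2, and by uniqueness of partial fractions these are jointly injective.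
  Thus X_ij consists of the elements whose value at every s is a multiple of the value of x_ij, and
  the claim holds because x_ab, x_bc, x_cd become a basis of sl_2 with coordinate change over
  F[t, 1/t, 1/(1 - t)].
*)

theory Submission
  imports Defs "HOL-Library.Product_Plus" "HOL-Computational_Algebra.Polynomial"
begin

section \<open>Maps from the three-dimensional simple Lie algebra\<close>

text \<open>The algebra is given only by generators and relations, so there are no coordinates to
  compute in: spanning bounds it from above, and evaluations, which exist by the universal property,
  bound it from below. On the spanning side no ring acts on the algebra. A tensor factor
  \<open>p\<close> is visible only through the elements \<open>u \<otimes> p\<close>, a product of
  factors is a relation to be proved each time, and even associativity has to be extracted from the
  Jacobi identity. On the other side no loop algebra is constructed: coordinate functions on the
  points \<open>s\<close> other than 0 and 1 carry the same information, because the field is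
  infinite. Characteristic zero also removes the trivial-module part of each level, which becomes 0
  after multiplication by a positive integer. The shape of the path enters through a determinant:
  the values of \<open>x a b\<close>, \<open>x b c\<close>, \<open>x c d\<close> in the basis
  \<open>e, h, f\<close> have determinant \<open>s - 1\<close>, a unit among the functions that
  occur.\<close>

locale lie_algebra_char_0 = lie_algebra scale bracket
  for scale :: "'f::field_char_0 \<Rightarrow> 'v::ab_group_add \<Rightarrow> 'v" and bracket
begin

lemma bracket_zero_left [simp]: "bracket 0 a = 0"
  by (metis bracket_add_left add_cancel_right_right)

lemma bracket_zero_right [simp]: "bracket a 0 = 0"
  by (metis bracket_add_right add_cancel_right_right)

lemma bracket_minus_left: "bracket (- a) b = - bracket a b"
  by (metis bracket_add_left bracket_zero_left add.right_inverse minus_unique)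

lemma bracket_minus_right: "bracket a (- b) = - bracket a b"
  by (metis bracket_add_right bracket_zero_right add.right_inverse minus_unique)

lemma bracket_diff_left: "bracket (a - b) c = bracket a c - bracket b c"
  using bracket_add_left[of a "- b" c] by (simp add: bracket_minus_left)

lemma bracket_diff_right: "bracket a (b - c) = bracket a b - bracket a c"
  using bracket_add_right[of a b "- c"] by (simp add: bracket_minus_right)

lemma bracket_swap: "bracket a b = - bracket b a"
proof -
  have "bracket (a + b) (a + b) = 0" by (rule bracket_self)
  then have "bracket a b + bracket b a = 0"
    unfolding bracket_add_left bracket_add_right by (simp add: bracket_self add.commute)
  then show ?thesis by (simp add: eq_neg_iff_add_eq_0)
qed

lemma bracket_derivation:
  "bracket a (bracket b c) = bracket (bracket a b) c + bracket b (bracket a c)"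
proof -
  have "bracket a (bracket b c) + bracket b (bracket c a) + bracket c (bracket a b) = 0"
    by (rule jacobi)
  moreover have "bracket b (bracket c a) = - bracket b (bracket a c)"
    by (metis bracket_swap bracket_minus_right)
  moreover have "bracket c (bracket a b) = - bracket (bracket a b) c"
    by (rule bracket_swap)
  ultimately show ?thesis by (simp add: algebra_simps)
qed

lemmas bracket_linear = bracket_add_left bracket_add_right bracket_minus_left bracket_minus_right
  bracket_diff_left bracket_diff_right bracket_scale_left bracket_scale_right

text \<open>
  A triple \<open>(E, H, F)\<close> stands for a map \<open>u \<mapsto> u \<otimes> p\<close> from \<open>sl\<^sub>2\<close> into the algebra, given by its values at
  a basis \<open>e, h, f\<close> with \<open>[h, e] = 2e\<close>, \<open>[h, f] = -2f\<close>, \<open>[e, f] = -4h\<close>; this normalisation makes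
  \<open>f - h\<close>, \<open>h\<close>, \<open>e - h\<close> the equitable basis. \<open>mul P Q R\<close> says \<open>[u \<otimes> p, v \<otimes> q] = [u, v] \<otimes> r\<close>, that is,
  \<open>r = p q\<close>.
\<close>

definition mul :: "'v \<times> 'v \<times> 'v \<Rightarrow> 'v \<times> 'v \<times> 'v \<Rightarrow> 'v \<times> 'v \<times> 'v \<Rightarrow> bool" where
  "mul P Q R \<longleftrightarrow> (case (P, Q, R) of ((E1, H1, F1), (E2, H2, F2), (E3, H3, F3)) \<Rightarrow>
     bracket E1 E2 = 0 \<and> bracket H1 H2 = 0 \<and> bracket F1 F2 = 0 \<and>
     bracket H1 E2 = scale 2 E3 \<and> bracket E1 H2 = scale (-2) E3 \<and>
     bracket H1 F2 = scale (-2) F3 \<and> bracket F1 H2 = scale 2 F3 \<and>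
     bracket E1 F2 = scale (-4) H3 \<and> bracket F1 E2 = scale 4 H3)"

lemma mul_commute:
  assumes "mul P Q R"
  shows "mul Q P R"
proof -
  obtain E1 H1 F1 E2 H2 F2 E3 H3 F3 where PQR: "P = (E1, H1, F1)" "Q = (E2, H2, F2)" "R = (E3, H3, F3)"
    by (metis prod.exhaust)
  show ?thesis
    using assms unfolding PQR mul_def
    by (simp add: bracket_swap[of E2] bracket_swap[of H2] bracket_swap[of F2])
qed

lemma mul_diff_right: "mul P Q R \<Longrightarrow> mul P Q' R' \<Longrightarrow> mul P (Q - Q') (R - R')"
  unfolding mul_def by (auto simp: bracket_linear scale_right_diff_distrib split: prod.splits)

lemma mul_diff_left: "mul P Q R \<Longrightarrow> mul P' Q R' \<Longrightarrow> mul (P - P') Q (R - R')"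
  by (metis mul_commute mul_diff_right)

text \<open>The change of basis that permutes the equitable basis cyclically.\<close>

definition rot :: "'v \<times> 'v \<times> 'v \<Rightarrow> 'v \<times> 'v \<times> 'v" where
  "rot P = (case P of (E, H, F) \<Rightarrow> (E + F - scale 2 H, E - H, E))"

lemma scale_two: "scale 2 a = a + a"
  using scale_left_distrib[of 1 1 a] by simp

lemma rot_rot_rot: "rot (rot (rot P)) = P"
  by (cases P) (simp add: rot_def algebra_simps scale_two)

lemma rot_diff: "rot (P - Q) = rot P - rot Q"
  by (cases P; cases Q) (simp add: rot_def algebra_simps)

lemma scale_four: "scale 4 a = a + a + a + a"
  using scale_left_distrib[of 2 2 a] by (simp add: scale_two)

text \<open>The entries of \<open>rot P\<close> are the values of the same map at the basis
  \<open>e + f - 2h\<close>, \<open>e - h\<close>, \<open>e\<close>, which has the same brackets as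
  \<open>e, h, f\<close>.\<close>

lemma mul_rot:
  assumes "mul P Q R"
  shows "mul (rot P) (rot Q) (rot R)"
proof -
  obtain E1 H1 F1 E2 H2 F2 E3 H3 F3 where PQR: "P = (E1, H1, F1)" "Q = (E2, H2, F2)" "R = (E3, H3, F3)"
    by (metis prod.exhaust)
  have "bracket E1 E2 = 0" "bracket H1 H2 = 0" "bracket F1 F2 = 0"
     "bracket H1 E2 = scale 2 E3" "bracket E1 H2 = scale (-2) E3"
     "bracket H1 F2 = scale (-2) F3" "bracket F1 H2 = scale 2 F3"
     "bracket E1 F2 = scale (-4) H3" "bracket F1 E2 = scale 4 H3"
    using assms unfolding PQR mul_def by auto
  then show ?thesis
    unfolding PQR mul_def rot_def
    by (simp add: bracket_linear) (simp add: scale_two scale_four algebra_simps)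
qed

end

locale sl2_triple = lie_algebra_char_0 scale bracket
  for scale :: "'f::field_char_0 \<Rightarrow> 'v::ab_group_add \<Rightarrow> 'v" and bracket +
  fixes e h f :: 'v
  assumes he: "bracket h e = scale 2 e" and hf: "bracket h f = scale (-2) f"
    and ef: "bracket e f = scale (-4) h"
begin

lemma mul_triple: "mul (e, h, f) (e, h, f) (e, h, f)"
  using he hf ef bracket_swap[of e h] bracket_swap[of f h] bracket_swap[of f e]
  unfolding mul_def by (simp add: bracket_self)

text \<open>\<open>P\<close> is equivariant for the subalgebra spanned by \<open>e, h, f\<close>.\<close>

definition adj :: "'v \<times> 'v \<times> 'v \<Rightarrow> bool" where
  "adj P \<longleftrightarrow> mul (e, h, f) P P"

lemma adjD:
  assumes "adj (E, H, F)"
  shows "bracket e E = 0" "bracket e H = scale (-2) E" "bracket e F = scale (-4) H"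
    "bracket h E = scale 2 E" "bracket h H = 0" "bracket h F = scale (-2) F"
    "bracket f E = scale 4 H" "bracket f H = scale 2 F" "bracket f F = 0"
  using assms by (auto simp: adj_def mul_def)

text \<open>
  The vector \<open>e \<otimes> f\<close> generates the \<open>sl\<^sub>2\<close>-module \<open>sl\<^sub>2 \<otimes> sl\<^sub>2\<close>, so one bracket determines all nine.
\<close>

lemma mul_from_nilpotent:
  assumes P: "adj (E1, H1, F1)" and Q: "adj (E2, H2, F2)" and R: "adj (E3, H3, F3)"
    and EF: "bracket E1 F2 = scale (-4) H3"
  shows "mul (E1, H1, F1) (E2, H2, F2) (E3, H3, F3)"
proof -
  note [simp] = adjD[OF P] adjD[OF Q] adjD[OF R] bracket_linear
  have cancel: "a = b" if "scale c a = scale c b" "c \<noteq> 0" for a b c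
    using that scale_left_imp_eq by blast
  have EH: "bracket E1 H2 = scale (-2) E3"
    using bracket_derivation[of e E1 F2] EF by - (rule cancel[of "-4"], simp_all)
  have EE: "bracket E1 E2 = 0"
    using bracket_derivation[of e E1 H2] EH by simp
  have HF: "bracket H1 F2 = scale (-2) F3"
    using bracket_derivation[of f E1 F2] EF by - (rule cancel[of 4], simp_all)
  have FF: "bracket F1 F2 = 0"
    using bracket_derivation[of f H1 F2] HF by simp
  have HE: "bracket H1 E2 = scale 2 E3"
    using bracket_derivation[of f E1 E2] EE EH by - (rule cancel[of 4], (simp_all add: algebra_simps))
  have HH: "bracket H1 H2 = 0"
    using bracket_derivation[of f E1 H2] EF EH by simp
  have FH: "bracket F1 H2 = scale 2 F3"
    using bracket_derivation[of f H1 H2] HF HH by - (rule cancel[of 2], (simp_all add: algebra_simps))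
  have FE: "bracket F1 E2 = scale 4 H3"
    using bracket_derivation[of f H1 E2] HE HH by - (rule cancel[of 2], simp_all)
  show ?thesis
    unfolding mul_def using EE HH FF HE EH HF FH EF FE by simp
qed

text \<open>The condition on \<open>f\<close> makes the module generated by \<open>v\<close> a
  quotient of the adjoint one. The factors 1/4 and 1/8 come from \<open>[f, e] = 4h\<close> and
  \<open>[f, h] = 2f\<close>.\<close>

lemma adj_from_highest_weight:
  assumes h: "bracket h v = scale 2 v" and e: "bracket e v = 0"
    and f: "bracket f (bracket f (bracket f v)) = 0"
  shows "adj (v, scale (1/4) (bracket f v), scale (1/8) (bracket f (bracket f v)))"
proof -
  note [simp] = bracket_linear he hf ef h e f
  have fh: "bracket f h = scale 2 f" "bracket h f = scale (-2) f"
    using hf bracket_swap[of f h] by simp_all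
  have hv: "bracket h (bracket f v) = 0"
    using bracket_derivation[of h f v] by simp
  have ev: "bracket e (bracket f v) = scale (-8) v"
    using bracket_derivation[of e f v] by simp
  have hv2: "bracket h (bracket f (bracket f v)) = scale (-2) (bracket f (bracket f v))"
    using bracket_derivation[of h f "bracket f v"] hv by simp
  have ev2: "bracket e (bracket f (bracket f v)) = scale (-8) (bracket f v)"
    using bracket_derivation[of e f "bracket f v"] ev hv by simp
  show ?thesis
    unfolding adj_def mul_def using hv ev hv2 ev2 by simp
qed

text \<open>This is \<open>a (b d) = (a b) d\<close>, read off from the Jacobi identity for
  \<open>Ea\<close>, \<open>Hb\<close>, \<open>Fd\<close>. The product of \<open>b\<close> with
  \<open>a d\<close> enters only through \<open>[Hb, He] = 0\<close>, so its value \<open>R\<close>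
  is arbitrary.\<close>

lemma mul_assoc:
  assumes "mul (Ea, Ha, Fa) (Eb, Hb, Fb) (Ec, Hc, Fc)" and "mul (Ec, Hc, Fc) (Ed, Hd, Fd) (Ez, Hz, Fz)"
    and "mul (Ea, Ha, Fa) (Ed, Hd, Fd) (Ee, He, Fe)" and "mul (Eb, Hb, Fb) (Ee, He, Fe) R"
    and "mul (Eb, Hb, Fb) (Ed, Hd, Fd) (En, Hn, Fn)"
    and adj: "adj (Ea, Ha, Fa)" "adj (En, Hn, Fn)" "adj (Ez, Hz, Fz)"
  shows "mul (Ea, Ha, Fa) (En, Hn, Fn) (Ez, Hz, Fz)"
proof (rule mul_from_nilpotent[OF adj])
  have "bracket Ea (bracket Hb Fd) = scale 8 Hz"
    using bracket_derivation[of Ea Hb Fd] assms(1-5)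
    by (cases R) (simp add: mul_def bracket_linear)
  then show "bracket Ea Fn = scale (-4) Hz"
    using assms(5) scale_left_imp_eq[of "-2" "bracket Ea Fn" "scale (-4) Hz"]
    by (simp add: mul_def bracket_linear)
qed

end

section \<open>Current algebras\<close>

locale sl2_current = sl2_triple scale bracket e h f
  for scale :: "'f::field_char_0 \<Rightarrow> 'v::ab_group_add \<Rightarrow> 'v" and bracket and e h f +
  fixes E1 H1 F1 :: 'v
  assumes adj_first: "adj (E1, H1, F1)"
    and serre: "bracket E1 (bracket E1 H1) = 0"
begin

text \<open>In a current algebra
  \<open>[h \<otimes> t, e \<otimes> t^n] = 2 e \<otimes> t^(n+1)\<close>, so half of the bracket
  with \<open>H1\<close> raises the power by one; \<open>H\<close> and \<open>F\<close> then follow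
  by lowering with \<open>f\<close>.\<close>

definition E :: "nat \<Rightarrow> 'v" where
  "E n = ((\<lambda>w. scale (1/2) (bracket H1 w)) ^^ n) e"

definition H :: "nat \<Rightarrow> 'v" where
  "H n = scale (1/4) (bracket f (E n))"

definition F :: "nat \<Rightarrow> 'v" where
  "F n = scale (1/2) (bracket f (H n))"

definition T :: "nat \<Rightarrow> 'v \<times> 'v \<times> 'v" where
  "T n = (E n, H n, F n)"

lemma E_Suc: "E (Suc n) = scale (1/2) (bracket H1 (E n))"
  by (simp add: E_def)

lemma T_0: "T 0 = (e, h, f)"
  using adjD[OF mul_triple[folded adj_def]] by (simp add: T_def E_def H_def F_def)

lemma T_1: "T 1 = (E1, H1, F1)"
proof -
  have "E 1 = E1"
    using adjD(2)[OF adj_first] bracket_swap[of H1 e] by (simp add: E_def)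
  then show ?thesis
    using adjD[OF adj_first] by (simp add: T_def H_def F_def)
qed

lemma mul_T_zero_iff: "mul (T 0) (T n) (T n) \<longleftrightarrow> adj (T n)"
  by (simp add: T_0 adj_def)

text \<open>Applying \<open>H b\<close> to a vanishing bracket of lower level moves \<open>b\<close>
  from one index to the other and changes the sign. For \<open>N \<ge> 4\<close>, moving 2 at once
  and moving 1 twice give opposite signs. For \<open>N = 2\<close> the two entries coincide; for
  \<open>N = 3\<close> there is no room for this comparison, and the bracket is a multiple of the
  one in \<open>serre\<close>.\<close>

lemma bracket_E_E:
  assumes IH: "\<And>m n. m + n < N \<Longrightarrow> mul (T m) (T n) (T (m + n))" and N: "N \<ge> 2"
    and m: "0 < m" "m < N"
  shows "bracket (E m) (E (N - m)) = 0"
proof -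
  have rel: "bracket (E m) (E n) = 0" "bracket (H m) (H n) = 0"
     "bracket (H m) (E n) = scale 2 (E (m + n))" "bracket (E m) (H n) = scale (-2) (E (m + n))"
    if "m + n < N" for m n
    using IH[OF that] by (auto simp: mul_def T_def)
  have step: "bracket (E (a + b)) (E c) = - bracket (E a) (E (b + c))"
    if abc: "a + b + c = N" "a > 0" "b > 0" "c > 0" for a b c
  proof -
    have "scale 2 (bracket (E (a + b)) (E c)) + scale 2 (bracket (E a) (E (b + c))) = 0"
      using bracket_derivation[of "H b" "E a" "E c"] rel(1)[of a c] rel(3)[of b a] rel(3)[of b c] abc
      by (simp add: bracket_linear add.commute)
    then have "scale 2 (bracket (E (a + b)) (E c) + bracket (E a) (E (b + c))) = 0"
      by (simp add: scale_right_distrib)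
    then show ?thesis
      by (simp add: eq_neg_iff_add_eq_0)
  qed
  have one: "bracket (E 1) (E (N - 1)) = 0"
  proof -
    consider "N = 2" | "N = 3" | "N \<ge> 4" using N by linarith
    then show ?thesis
    proof cases
      case 1 then show ?thesis by (simp add: bracket_self)
    next
      case 2
      have "E 2 = scale (1/2) (bracket H1 (E 1))"
        using E_Suc[of 1] by (simp add: numeral_2_eq_2)
      moreover have "E 1 = E1" using T_1 by (simp add: T_def)
      ultimately show ?thesis
        using serre bracket_swap[of H1 E1] 2 by (simp add: bracket_linear)
    next
      case 3
      define x where "x = bracket (E 1) (E (N - 1))"
      have 2: "bracket (E 2) (E (N - 2)) = - x"
        using step[of 1 1 "N - 2"] 3 by (simp add: x_def numeral_2_eq_2 Suc_diff_Suc)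
      have "bracket (E 3) (E (N - 3)) = - x"
        using step[of 1 2 "N - 3"] 3 by (simp add: x_def numeral_eq_Suc Suc_diff_Suc)
      moreover have "bracket (E 3) (E (N - 3)) = x"
        using step[of 2 1 "N - 3"] 2 3 by (simp add: numeral_eq_Suc Suc_diff_Suc)
      ultimately have "scale 2 x = 0"
        by (simp add: scale_two eq_neg_iff_add_eq_0)
      then show ?thesis by (simp add: x_def)
    qed
  qed
  show ?thesis
  proof (cases "m = 1")
    case False
    then show ?thesis
      using step[of 1 "m - 1" "N - m"] m one by simp
  qed (use one in simp)
qed

text \<open>
  Decompose the level \<open>N = m + n\<close> under \<open>sl\<^sub>2\<close>. The five-dimensional part is killed by
  \<open>bracket_E_E\<close>, the adjoint part does not depend on \<open>m\<close> by the Jacobi identity, and the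
  trivial part \<open>D m = [H m, H (N - m)]\<close> is additive in \<open>m\<close> and antisymmetric, whence \<open>N D 1 = 0\<close>.
\<close>

lemma mul_T: "mul (T m) (T n) (T (m + n))"
proof (induction "m + n" arbitrary: m n rule: less_induct)
  case less
  define N where "N = m + n"
  have IH: "mul (T a) (T b) (T (a + b))" if "a + b < N" for a b
    using less that by (simp add: N_def)
  show ?case
  proof (cases "N \<ge> 2")
    case False
    then have "(m = 0 \<and> n = 0) \<or> (m = 0 \<and> n = 1) \<or> (m = 1 \<and> n = 0)"
      by (auto simp: N_def)
    moreover have "mul (T 0) (T 0) (T 0)" "mul (T 0) (T 1) (T 1)"
      using mul_triple adj_first by (simp_all only: T_0 T_1 adj_def)
    ultimately show ?thesis
      using mul_commute by (metis add_0 add_0_right)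
  next
    case True
    have adj: "adj (E a, H a, F a)" if "a < N" for a
      using IH[of 0 a] that by (simp add: mul_T_zero_iff) (simp add: T_def)
    note ad = adjD[OF adj]
    have EE: "bracket (E a) (E b) = 0" if "a + b = N" "a > 0" "b > 0" for a b
      using bracket_E_E[OF IH True, of a] that by auto
    have cancel: "a = b" if "scale c a = scale c b" "c \<noteq> 0" for a b c
      using that scale_left_imp_eq by blast
    have HE_EH: "bracket (H a) (E b) = - bracket (E a) (H b)" if "a + b = N" "a > 0" "b > 0" for a b
    proof -
      have "scale 4 (bracket (H a) (E b) + bracket (E a) (H b)) = 0"
        using bracket_derivation[of f "E a" "E b"] ad(7)[of a] ad(7)[of b] EE[OF that] that
        by (simp add: bracket_linear scale_right_distrib)
      then show ?thesis
        by (simp add: eq_neg_iff_add_eq_0)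
    qed
    have relH: "bracket (H a) (H b) = 0" "bracket (H a) (E b) = scale 2 (E (a + b))"
      "bracket (E a) (F b) = scale (-4) (H (a + b))" "bracket (H a) (F b) = scale (-2) (F (a + b))"
      if "a + b < N" for a b
      using IH[OF that] by (auto simp: mul_def T_def)
    obtain M where M: "N = Suc M" "M > 0" using True by (cases N) auto
    have H1: "H (Suc 0) = H1" using T_1 by (simp add: T_def)
    have HE1: "bracket (H 1) (E M) = scale 2 (E N)"
      by (simp add: M E_Suc H1)
    \<comment> \<open>The splitting \<open>a = 1\<close> is the definition of \<open>E N\<close>.
      The others reduce to it because \<open>H a\<close> and \<open>H 1\<close> commute at lower
      level; \<open>b = 1\<close> leaves no positive \<open>c\<close> and is settled by antisymmetry
      instead.\<close>
    have HE: "bracket (H a) (E b) = scale 2 (E N)" if ab: "a + b = N" "a > 0" "b > 0" for a b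
    proof (cases "b = 1")
      case True
      have "bracket (H M) (E 1) = - bracket (E M) (H 1)"
        using HE_EH[of M 1] M by simp
      also have "\<dots> = bracket (H 1) (E M)"
        by (rule bracket_swap[symmetric])
      finally show ?thesis
        using HE1 True ab M by simp
    next
      case False
      define c where "c = b - 1"
      have c: "b = Suc c" "c > 0" using False ab by (auto simp: c_def)
      have "bracket (H a) (bracket (H 1) (E c)) = bracket (H 1) (bracket (H a) (E c))"
        using bracket_derivation[of "H a" "H 1" "E c"] relH(1)[of a 1] ab c by simp
      then have "scale 2 (bracket (H a) (E b)) = scale 2 (scale 2 (E N))"
        using relH(2)[of 1 c] relH(2)[of a c] ab c HE1 M by (simp add: bracket_linear)
      then show ?thesis by (rule cancel) simp
    qed
    have adjN: "adj (E N, H N, F N)"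
    proof -
      note adM = ad[of M, unfolded M(1), simplified] and ad1 = ad[of 1, unfolded M(1), simplified, OF M(2)]
      note [simp] = bracket_linear he hf ef adM ad1
      have EN: "E N = scale (1/2) (bracket (H (Suc 0)) (E M))" by (simp add: M E_Suc H1)
      have hE: "bracket h (E N) = scale 2 (E N)"
        using bracket_derivation[of h "H 1" "E M"] unfolding EN by simp
      have eE: "bracket e (E N) = 0"
        using bracket_derivation[of e "H 1" "E M"] EE[of 1 M] M unfolding EN by simp
      \<comment> \<open>These are the brackets of weights 0, -2 and -4. Lowering
        \<open>[E 1, E M] = 0\<close> four times leaves a nonzero multiple of \<open>Z\<close>, so
        \<open>Z = 0\<close>; lowering \<open>E N\<close> three times also leaves a multiple of
        \<open>Z\<close>.\<close>
      define X0 where "X0 = bracket (F 1) (E M)"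
      define X1 where "X1 = bracket (H 1) (H M)"
      define X2 where "X2 = bracket (E 1) (F M)"
      define Y0 where "Y0 = bracket (F 1) (H M)"
      define Y1 where "Y1 = bracket (H 1) (F M)"
      define Z where "Z = bracket (F 1) (F M)"
      have *: "scale 2 X0 + scale 4 X1 = - (scale 4 X1 + scale 2 X2)"
        using arg_cong[OF HE_EH[of 1 M], of "bracket f"] bracket_derivation[of f "H 1" "E M"]
          bracket_derivation[of f "E 1" "H M"] M
        by (simp add: X0_def X1_def X2_def)
      have fX: "bracket f X0 = scale 4 Y0" "bracket f X1 = scale 2 Y0 + scale 2 Y1"
        "bracket f X2 = scale 4 Y1"
        unfolding X0_def X1_def X2_def Y0_def Y1_def bracket_derivation[of f] by simp_all
      have fY: "bracket f Y0 = scale 2 Z" "bracket f Y1 = scale 2 Z"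
        unfolding Z_def Y0_def Y1_def bracket_derivation[of f] by simp_all
      have split: "scale 16 w = scale 8 w + scale 8 w" "scale 24 w = scale 8 w + scale 8 w + scale 8 w" for w
        by (simp_all flip: scale_left_distrib)
      have "scale 24 (Y0 + Y1) = 0"
        using arg_cong[OF *, of "bracket f"] by (simp add: fX split algebra_simps)
      then have "bracket f (Y0 + Y1) = 0"
        by simp
      then have "scale 4 Z = 0"
        by (simp add: fY flip: scale_left_distrib)
      then have Z: "Z = 0" by simp
      have "bracket f (bracket (H (Suc 0)) (E M)) = scale 2 X0 + scale 4 X1"
        unfolding X0_def X1_def bracket_derivation[of f] by simp
      then have fffE: "bracket f (bracket f (bracket f (E N))) = 0"
        unfolding EN by (simp add: fX fY Z)
      show ?thesis
        using adj_from_highest_weight[OF hE eE fffE] by (simp add: H_def F_def)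
    qed
    note adN = adjD[OF adjN]
    define D where "D a = bracket (H a) (H (N - a))" for a
    have G: "bracket (E a) (F b) = scale (-4) (H N) - scale 2 (D a)"
      if ab: "a + b = N" "a > 0" "b > 0" for a b
    proof -
      have "scale 2 (bracket (E a) (F b)) = scale 2 (scale (-4) (H N) - scale 2 (D a))"
      proof -
        have "bracket (H b) (E a) = scale 2 (E N)" using HE[of b a] ab by simp
        then have "bracket f (bracket (H b) (E a)) = scale 8 (H N)"
          using adN(7) by (simp add: bracket_linear)
        then have "scale 2 (bracket (F b) (E a)) + scale 4 (bracket (H b) (H a)) = scale 8 (H N)"
          using bracket_derivation[of f "H b" "E a"] ad(7)[of a] ad(8)[of b] ab by (simp add: bracket_linear)
        moreover have "bracket (H b) (H a) = - D a" 
          using bracket_swap[of "H b" "H a"] ab by (auto simp: D_def)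
        ultimately have "- scale 4 (D a) = scale 8 (H N) + scale 2 (bracket (E a) (F b))"
          using bracket_swap[of "F b" "E a"] by (simp add: algebra_simps)
        then have "scale 4 (D a) = - (scale 8 (H N) + scale 2 (bracket (E a) (F b)))"
          by (metis minus_minus)
        then show ?thesis
          by (simp add: algebra_simps)
      qed
      then show ?thesis by (rule cancel) simp
    qed
    \<comment> \<open>Jacobi for \<open>H a\<close>, \<open>E b\<close>, \<open>F c\<close>. By
      \<open>G\<close> both terms of the derivation rule contain \<open>H N\<close>, with opposite
      coefficients, so only values of \<open>D\<close> remain.\<close>
    have D_add: "D (a + b) = D a + D b" if abc: "a + b < N" "a > 0" "b > 0" for a b
    proof -
      define c where "c = N - (a + b)"
      have c: "a + b + c = N" "c > 0" using abc by (auto simp: c_def)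
      have "scale (-4) (D a) = bracket (H a) (bracket (E b) (F c))"
        using relH(3)[of b c] abc c by (auto simp: bracket_linear D_def)
      also have "\<dots> = scale 2 (bracket (E (a + b)) (F c)) + scale (-2) (bracket (E b) (F (a + c)))"
        using bracket_derivation[of "H a" "E b" "F c"] relH(2)[of a b] relH(4)[of a c] abc c
        by (simp add: bracket_linear)
      also have "\<dots> = scale (-4) (D (a + b)) + scale 4 (D b)"
      proof -
        have G': "bracket (E (a + b)) (F c) = scale (-4) (H N) - scale 2 (D (a + b))"
          "bracket (E b) (F (a + c)) = scale (-4) (H N) - scale 2 (D b)"
          using abc c by (simp_all add: G)
        show ?thesis
          unfolding G' by (simp add: scale_right_diff_distrib)
      qed
      finally have "scale 4 (D (a + b)) = scale 4 (D a + D b)"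
        by (simp add: algebra_simps)
      then show ?thesis by (rule cancel) simp
    qed
    have D_mult: "D a = scale (of_nat a) (D 1)" if "a < N" "a > 0" for a
      using that(2,1)
    proof (induction a rule: nat_induct_non_zero)
      case 1
      then show ?case by simp
    next
      case (Suc a)
      then show ?case
        using D_add[of a 1] by (simp add: scale_left_distrib add.commute)
    qed
    have "D M = - D 1"
      using bracket_swap[of "H M" "H 1"] by (simp add: D_def M)
    then have "scale (of_nat N) (D 1) = 0"
      using D_mult[of M] M by (simp add: scale_left_distrib)
    then have "D 1 = 0"
      using M(1) by (simp only: scale_eq_0_iff of_nat_eq_0_iff nat.distinct simp_thms)
    then have EF: "bracket (E a) (F b) = scale (-4) (H N)" if "a + b = N" "a > 0" "b > 0" for a b
      using G[OF that] D_mult[of a] that by simp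
    show ?thesis
    proof (cases "m = 0 \<or> n = 0")
      case True
      have "mul (T 0) (T N) (T N)"
        using adjN by (simp add: mul_T_zero_iff) (simp add: T_def)
      then show ?thesis
        using True mul_commute[of "T 0" "T N" "T N"] unfolding N_def by auto
    next
      case False
      then have "m < N" "n < N" "m + n = N" by (auto simp: N_def)
      then show ?thesis
        unfolding T_def using False EF[of m n]
          mul_from_nilpotent[OF adj[of m] adj[of n] adjN] by simp
    qed
  qed
qed

end

section \<open>Spanning the tetrahedron algebra\<close>

locale tetrahedron = lie_algebra_char_0 scale bracket
  for scale :: "'f::field_char_0 \<Rightarrow> 'v::ab_group_add \<Rightarrow> 'v" and bracket +
  fixes x :: "'i \<Rightarrow> 'i \<Rightarrow> 'v"
  assumes x_add_swap: "i \<noteq> j \<Longrightarrow> x i j + x j i = 0"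
    and x_adjacent: "distinct [i, j, k] \<Longrightarrow>
      bracket (x i j) (x j k) = scale 2 (x i j) + scale 2 (x j k)"
    and x_opposite: "distinct [h, i, j, k] \<Longrightarrow>
      bracket (x i j) (bracket (x i j) (bracket (x i j) (x k h))) = scale 4 (bracket (x i j) (x k h))"
begin

lemma scale_expand: "scale 2 w = w + w" "scale 4 w = scale 2 w + scale 2 w"
  "scale 8 w = scale 4 w + scale 4 w" "scale 16 w = scale 8 w + scale 8 w"
  by (rule scale_two) (simp_all flip: scale_left_distrib)

lemma x_swap: "i \<noteq> j \<Longrightarrow> x j i = - x i j"
  using x_add_swap[of j i] by (simp add: eq_neg_iff_add_eq_0)

text \<open>In the frame \<open>a, b, c\<close> the equitable basis is \<open>x a b\<close>, \<open>x b c\<close>, \<open>x c a\<close>.\<close>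

definition triple :: "'i \<Rightarrow> 'i \<Rightarrow> 'i \<Rightarrow> 'v \<times> 'v \<times> 'v" where
  "triple a b c = (x b c + x c a, x b c, x a b + x b c)"

lemma rot_triple: "rot (triple a b c) = triple b c a"
  by (simp add: rot_def triple_def scale_two algebra_simps)

lemma x_adjacent_swap:
  "distinct [i, j, k] \<Longrightarrow> bracket (x j k) (x i j) = - scale 2 (x i j) - scale 2 (x j k)"
  by (subst bracket_swap) (simp add: x_adjacent)

lemma x_adjacent_target:
  assumes "distinct [i, j, k]"
  shows "bracket (x i j) (x k j) = scale 2 (x k j) - scale 2 (x i j)"
proof -
  have "x k j = - x j k"
    using assms by (intro x_swap) auto
  then show ?thesis
    using assms by (simp add: bracket_minus_right x_adjacent algebra_simps)
qed

lemma sl2_triple_triangle: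
  assumes "distinct [a, b, c]"
  shows "sl2_triple scale bracket (x b c + x c a) (x b c) (x a b + x b c)"
proof -
  have "distinct [b, c, a]" "distinct [c, a, b]" using assms by auto
  with assms show ?thesis
    by unfold_locales
      (simp_all add: bracket_add_left bracket_add_right bracket_self x_adjacent x_adjacent_swap
        scale_right_distrib, simp_all add: scale_two scale_four algebra_simps)
qed

text \<open>\<open>E\<close> is to become \<open>e \<otimes> t\<close>; it is the highest weight
  vector in \<open>x d c = E - e + h\<close>. Relation (iii) for the opposite edges
  \<open>ab\<close> and \<open>dc\<close> is used in both directions: \<open>x a b = f - h\<close>
  acting on \<open>x d c\<close> yields \<open>[f, [f, [f, E]]] = 0\<close>, and
  \<open>x d c\<close> acting on \<open>x a b\<close> yields \<open>[E, [E, H]] = 0\<close>.\<close>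

lemma sl2_current_tetrahedron:
  assumes abcd: "distinct [a, b, c, d]"
  defines "e \<equiv> x b c + x c a" and "h \<equiv> x b c" and "f \<equiv> x a b + x b c" and "E \<equiv> x d c + x c a"
  defines "H \<equiv> scale (1/4) (bracket f E)" and "F \<equiv> scale (1/8) (bracket f (bracket f E))"
  shows "sl2_current scale bracket e h f E H F"
proof -
  have dist: "distinct [a, b, c]" "distinct [b, c, a]" "distinct [c, a, b]" "distinct [d, c, a]"
    "distinct [d, c, b]" "distinct [b, c, d]" using abcd by auto
  interpret sl2_triple scale bracket e h f
    unfolding e_def h_def f_def by (rule sl2_triple_triangle) (use abcd in simp)
  note bracket_x = bracket_add_left bracket_add_right bracket_self x_adjacent x_adjacent_swap
    x_adjacent_target scale_right_distrib
  have ab: "x a b = f - h" and ca: "x c a = e - h" and dc: "x d c = E - e + h"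
    by (simp_all add: e_def f_def h_def E_def)
  have hE: "bracket h E = scale 2 E"
    unfolding h_def E_def using dist by (simp add: bracket_x)
  have eE: "bracket e E = 0"
    unfolding e_def E_def using dist
    by (simp add: bracket_x bracket_swap[of "x c a" "x d c"])
  define v1 where "v1 = bracket f E"
  define v2 where "v2 = bracket f v1"
  define v3 where "v3 = bracket f v2"
  have hv1: "bracket h v1 = 0"
    using bracket_derivation[of h f E] by (simp add: v1_def hf hE bracket_linear)
  have hv2: "bracket h v2 = scale (-2) v2"
    using bracket_derivation[of h f v1] by (simp add: v2_def hf hv1 bracket_linear)
  have "bracket (f - h) (bracket (f - h) (bracket (f - h) (E - e + h)))
      = scale 4 (bracket (f - h) (E - e + h))"
    using x_opposite[of c a b d] abcd unfolding ab dc by auto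
  moreover have "bracket f h = scale 2 f" "bracket f e = scale 4 h"
    using hf ef bracket_swap[of f h] bracket_swap[of f e] by simp_all
  ultimately have "v3 = 0"
    by (simp add: bracket_linear v1_def[symmetric] v2_def[symmetric] v3_def[symmetric] hE hv1 hv2
        he hf ef bracket_self) (simp add: scale_expand algebra_simps)
  then have fff: "bracket f (bracket f (bracket f E)) = 0"
    by (simp add: v1_def v2_def v3_def)
  have adj: "adj (E, H, F)"
    using adj_from_highest_weight[OF hE eE fff] by (simp add: H_def F_def)
  define P where "P = bracket E H"
  have eP: "bracket e P = 0" 
    using bracket_derivation[of e E H] adjD[OF adj] by (simp add: P_def bracket_linear bracket_self)
  have hP: "bracket h P = scale 2 P" 
    using bracket_derivation[of h E H] adjD[OF adj] by (simp add: P_def bracket_linear)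
  have "bracket (E - e + h) (bracket (E - e + h) (bracket (E - e + h) (f - h)))
      = scale 4 (bracket (E - e + h) (f - h))"
    using x_opposite[of b d c a] abcd unfolding ab dc by auto
  moreover have "bracket E f = scale (-4) H" "bracket E h = scale (-2) E" "bracket E e = 0"
     "bracket e h = scale (-2) e"
    using adjD[OF adj] he bracket_swap[of E f] bracket_swap[of E h] bracket_swap[of E e]
      bracket_swap[of e h] by simp_all
  ultimately have "bracket E P + bracket E P + bracket E P + bracket E P = 0"
    by (simp add: bracket_linear P_def[symmetric] eP hP adjD[OF adj] he hf ef bracket_self) (simp add: scale_expand algebra_simps)
  then have "bracket E P = 0"
    by (simp flip: scale_four)
  then have "bracket E (bracket E H) = 0"
    by (simp add: P_def)
  with adj show ?thesis
    by unfold_locales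
qed

end

section \<open>Products of powers of different elements\<close>

context lie_algebra_char_0
begin

lemma mul_assoc_triple:
  assumes I: "mul I I I" and "mul I A A" "mul I N N" "mul I Z Z"
    and "mul A B C" "mul C D Z" "mul A D L" "mul B L R" "mul B D N"
  shows "mul A N Z"
proof -
  obtain e h f where ehf: "I = (e, h, f)" by (cases I) auto
  interpret sl2_triple scale bracket e h f
    using I unfolding ehf mul_def by unfold_locales auto
  have [simp]: "(fst P, fst (snd P), snd (snd P)) = P" for P :: "'v \<times> 'v \<times> 'v"
    by simp
  let ?E = fst and ?H = "\<lambda>P. fst (snd P)" and ?F = "\<lambda>P. snd (snd P)"
  show ?thesis
    using mul_assoc[of "?E A" "?H A" "?F A" "?E B" "?H B" "?F B" "?E C" "?H C" "?F C"
        "?E D" "?H D" "?F D" "?E Z" "?H Z" "?F Z" "?E L" "?H L" "?F L" R "?E N" "?H N" "?F N"] assms(2-)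
    unfolding ehf adj_def by simp
qed

definition comps :: "'v \<times> 'v \<times> 'v \<Rightarrow> 'v set" where
  "comps P = {fst P, fst (snd P), snd (snd P)}"

lemma bracket_comps:
  assumes "mul P Q R" "comps R \<subseteq> S" "subspace S" "g \<in> comps P" "w \<in> comps Q"
  shows "bracket g w \<in> S"
proof -
  obtain E1 H1 F1 E2 H2 F2 E3 H3 F3 where PQR: "P = (E1, H1, F1)" "Q = (E2, H2, F2)" "R = (E3, H3, F3)"
    by (metis prod.exhaust)
  show ?thesis
    using assms unfolding PQR mul_def comps_def
    by (auto simp: subspace_0 subspace_scale subspace_neg)
qed

lemma comps_diff: "comps P \<subseteq> S \<Longrightarrow> comps Q \<subseteq> S \<Longrightarrow> subspace S \<Longrightarrow> comps (P - Q) \<subseteq> S"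
  by (auto simp: comps_def subspace_diff)

definition power_triples :: "(nat \<Rightarrow> 'v \<times> 'v \<times> 'v) \<Rightarrow> bool" where
  "power_triples T \<longleftrightarrow> (\<forall>m n. mul (T m) (T n) (T (m + n)))"

lemma power_triplesD: "power_triples T \<Longrightarrow> m + n = k \<Longrightarrow> mul (T m) (T n) (T k)"
  by (auto simp: power_triples_def)

lemma power_triples_rot: "power_triples T \<Longrightarrow> power_triples (\<lambda>n. rot (T n))"
  by (auto simp: power_triples_def mul_rot)

text \<open>
  If \<open>t p = p - 1\<close>, then \<open>t\<^sup>n p = p - (1 + t + \<dots> + t\<^sup>n\<^sup>-\<^sup>1)\<close>, which is \<open>falling_mul\<close>; if \<open>p t = t - 1\<close>, then
  \<open>p t\<^sup>n\<^sup>+\<^sup>1 = t\<^sup>n\<^sup>+\<^sup>1 - t\<^sup>n\<close>. These are the two ways in which \<open>t\<close>, \<open>1 - 1/t\<close>, \<open>1/(1 - t)\<close> multiply.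
\<close>

primrec falling_mul :: "'v \<times> 'v \<times> 'v \<Rightarrow> (nat \<Rightarrow> 'v \<times> 'v \<times> 'v) \<Rightarrow> nat \<Rightarrow> 'v \<times> 'v \<times> 'v" where
  "falling_mul P T 0 = P"
| "falling_mul P T (Suc n) = falling_mul P T n - T n"

lemma mul_falling:
  assumes T: "power_triples T" and P: "mul (T 0) P P" and TP: "mul (T 1) P (P - T 0)"
  shows "mul P (T n) (falling_mul P T n)"
proof -
  have I: "mul (T 0) (T n) (T n)" for n
    using T by (rule power_triplesD) simp
  \<comment> \<open>The last claim is the goal. Its induction step is associativity for
    \<open>P\<close>, \<open>T 1\<close>, \<open>T n\<close>, and the auxiliary product required
    there, \<open>T 1\<close> times \<open>P T n\<close>, is the second claim.\<close>
  have "mul (T 0) (falling_mul P T n) (falling_mul P T n) \<and>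
    mul (T 1) (falling_mul P T n) (falling_mul P T (Suc n)) \<and> mul P (T n) (falling_mul P T n)"
  proof (induction n)
    case 0
    then show ?case
      using P TP mul_commute by auto
  next
    case (Suc n)
    let ?X = "falling_mul P T"
    have X: "mul (T 0) (?X n) (?X n)" "mul (T 1) (?X n) (?X (Suc n))" "mul P (T n) (?X n)"
      using Suc by auto
    have TS: "mul (T 1) (T n) (T (Suc n))"
      using T by (rule power_triplesD) simp
    have X0: "mul (T 0) (?X (Suc n)) (?X (Suc n))"
      using mul_diff_right[OF X(1) I[of n]] by simp
    have X1: "mul (T 1) (?X (Suc n)) (?X (Suc (Suc n)))"
      using mul_diff_right[OF X(2) TS] by simp
    have "mul P (T (Suc n)) (?X (Suc n))"
    proof (rule mul_assoc_triple)
      show "mul P (T 1) (P - T 0)"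
        using TP by (rule mul_commute)
      show "mul (P - T 0) (T n) (?X (Suc n))"
        using mul_diff_left[OF X(3) I[of n]] by simp
    qed (use I P X0 X TS in auto)
    with X0 X1 show ?case by blast
  qed
  then show ?thesis by blast
qed

lemma mul_step:
  assumes T: "power_triples T" and P: "mul (T 0) P P" and TP: "mul P (T 1) (T 1 - T 0)"
  shows "mul P (T (Suc n)) (T (Suc n) - T n)"
proof (induction n)
  case 0
  then show ?case using TP by simp
next
  case (Suc n)
  have T': "mul (T 0) (T n) (T n)" "mul (T 1) (T n) (T (Suc n))" for n
    using T by (auto intro: power_triplesD)
  show ?case
  proof (rule mul_assoc_triple[OF T'(1) P T'(1) _ TP _ Suc _ T'(2)])
    show "mul (T 0) (T (Suc (Suc n)) - T (Suc n)) (T (Suc (Suc n)) - T (Suc n))"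
      by (intro mul_diff_right T')
    show "mul (T 1 - T 0) (T (Suc n)) (T (Suc (Suc n)) - T (Suc n))"
      by (intro mul_diff_left T')
    show "mul (T 1) (T (Suc n) - T n) (T (Suc (Suc n)) - T (Suc n))"
      by (intro mul_diff_right T')
  qed
qed

text \<open>Meant for \<open>P\<close> and \<open>T 1\<close> being two different ones of
  \<open>t\<close>, \<open>1 - 1/t\<close>, \<open>1/(1 - t)\<close>. Their multiplication rules are
  cyclic, so the product is \<open>P - 1\<close> or \<open>T 1 - 1\<close> according to which of the
  two follows the other.\<close>

lemma bracket_powers:
  assumes T: "power_triples T" and S: "subspace S" "\<And>n. comps (T n) \<subseteq> S" "comps P \<subseteq> S"
    and P: "mul (T 0) P P" and TP: "mul P (T 1) (P - T 0) \<or> mul P (T 1) (T 1 - T 0)"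
    and g: "g \<in> comps P" and w: "w \<in> comps (T n)"
  shows "bracket g w \<in> S"
  using TP
proof
  assume TP: "mul P (T 1) (P - T 0)"
  have "comps (falling_mul P T n) \<subseteq> S"
    by (induction n) (use S comps_diff in auto)
  moreover have "mul P (T n) (falling_mul P T n)"
    using T P mul_commute[OF TP] by (rule mul_falling)
  ultimately show ?thesis
    using bracket_comps S(1) g w by blast
next
  assume TP: "mul P (T 1) (T 1 - T 0)"
  show ?thesis
  proof (cases n)
    case 0
    then show ?thesis
      using bracket_comps[OF mul_commute[OF P]] S g w by auto
  next
    case (Suc m)
    have "comps (T (Suc m) - T m) \<subseteq> S"
      using S comps_diff by auto
    then show ?thesis
      using bracket_comps[OF mul_step[OF T P TP]] S(1) g w Suc by blast
  qed
qed

end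

section \<open>Power sequences from the tetrahedron relations and the spanning set\<close>

context tetrahedron
begin

lemma powers_tetrahedron:
  assumes "distinct [a, b, c, d]"
  shows "\<exists>T. power_triples T \<and> T 0 = triple a b c \<and> fst (T 1) = x d c + x c a"
proof -
  interpret cur: sl2_current scale bracket "x b c + x c a" "x b c" "x a b + x b c" "x d c + x c a"
    "scale (1/4) (bracket (x a b + x b c) (x d c + x c a))"
    "scale (1/8) (bracket (x a b + x b c) (bracket (x a b + x b c) (x d c + x c a)))"
    using assms by (rule sl2_current_tetrahedron)
  show ?thesis
    using cur.mul_T cur.T_0 cur.T_1
    by (intro exI[of _ cur.T]) (simp add: power_triples_def triple_def)
qed

text \<open>This is the source of \<open>t' t = t - 1\<close>. The last component of
  \<open>rot P\<close> is \<open>E\<close> itself, so by \<open>mul_from_nilpotent\<close> the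
  single bracket of \<open>fst Q\<close> with \<open>fst P\<close> decides everything, and relation
  (ii) at the vertex \<open>d\<close> computes it.\<close>

lemma mul_frames:
  assumes abcd: "distinct [a, b, c, d]"
    and P: "mul (triple a b c) P P" "fst P = x d c + x c a"
    and Q: "mul (triple b c a) Q Q" "fst Q = x d a + x a b"
  shows "mul Q (rot P) (rot P - triple b c a)"
proof -
  interpret sl2_triple scale bracket "x c a + x a b" "x c a" "x b c + x c a"
    using abcd by (intro sl2_triple_triangle) auto
  have adj_iff: "adj P \<longleftrightarrow> mul (triple b c a) P P" for P
    by (simp add: adj_def triple_def)
  obtain E H F where EHF: "P = (E, H, F)" by (cases P) auto
  obtain E' H' F' where EHF': "Q = (E', H', F')" by (cases Q) auto
  have E: "E = x d c + x c a" and E': "E' = x d a + x a b"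
    using P Q by (simp_all add: EHF EHF')
  have I: "mul (triple b c a) (triple b c a) (triple b c a)"
    using mul_triple by (simp add: triple_def)
  have rP: "mul (triple b c a) (rot P) (rot P)"
    using mul_rot[OF P(1)] by (simp add: rot_triple)
  have fE: "bracket (x a b + x b c) E = scale 4 H" "bracket (x b c) E = scale 2 E"
    using P(1) by (auto simp: EHF triple_def mul_def)
  then have xE: "bracket (x a b) E = scale 4 H - scale 2 E"
    by (simp add: bracket_add_left algebra_simps)
  have "bracket (x d a) (x d c) = scale 2 (x d a) - scale 2 (x d c)"
  proof -
    have "bracket (x a d) (x d c) = scale 2 (x a d) + scale 2 (x d c)"
      using abcd by (intro x_adjacent) auto
    moreover have "x d a = - x a d" using abcd by (intro x_swap) auto
    ultimately show ?thesis by (simp add: bracket_minus_left)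
  qed
  moreover have "bracket (x d a) (x c a) = scale 2 (x c a) - scale 2 (x d a)"
    using abcd by (intro x_adjacent_target) auto
  ultimately have "bracket (x d a) E = scale 2 (x c a) - scale 2 (x d c)"
    unfolding E bracket_add_right by simp
  then have "bracket E' E = scale (-4) (E - H - x c a)"
    unfolding E' bracket_add_left xE
    by (simp add: E scale_right_distrib) (simp add: scale_expand algebra_simps)
  moreover have "adj Q" "adj (rot P)" "adj (rot P - triple b c a)"
    unfolding adj_iff using Q(1) rP mul_diff_right[OF rP I] by auto
  ultimately show ?thesis
    unfolding EHF EHF' by (simp add: rot_def triple_def mul_from_nilpotent)
qed

end

context lie_algebra_char_0
begin

lemma bracket_span:
  assumes S: "subspace S" and "\<And>g w. g \<in> G \<Longrightarrow> w \<in> W \<Longrightarrow> bracket g w \<in> S"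
    and g: "g \<in> span G" and w: "w \<in> span W"
  shows "bracket g w \<in> S"
proof -
  have *: "bracket g w \<in> S" if "g \<in> G" for g
    using w
    by (induction rule: span_induct_alt)
      (use that assms in \<open>auto simp: bracket_linear subspace_0 subspace_add subspace_scale\<close>)
  show ?thesis
    using g
    by (induction rule: span_induct_alt)
      (use * S in \<open>auto simp: bracket_linear subspace_0 subspace_add subspace_scale\<close>)
qed

definition power_span ::
  "(nat \<Rightarrow> 'v \<times> 'v \<times> 'v) \<Rightarrow> (nat \<Rightarrow> 'v \<times> 'v \<times> 'v) \<Rightarrow> (nat \<Rightarrow> 'v \<times> 'v \<times> 'v) \<Rightarrow> 'v set"
  where "power_span A B C = span (\<Union>n. comps (A n) \<union> comps (B n) \<union> comps (C n))"

end

context tetrahedron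
begin

text \<open>\<open>A\<close>, \<open>B\<close>, \<open>C\<close> are the powers of \<open>t\<close>, \<open>1 - 1/t\<close> and \<open>1/(1 - t)\<close>.\<close>

definition frame_powers ::
  "'i \<Rightarrow> 'i \<Rightarrow> 'i \<Rightarrow> 'i \<Rightarrow> (nat \<Rightarrow> 'v \<times> 'v \<times> 'v) \<Rightarrow> (nat \<Rightarrow> 'v \<times> 'v \<times> 'v) \<Rightarrow> (nat \<Rightarrow> 'v \<times> 'v \<times> 'v) \<Rightarrow> bool"
  where "frame_powers a b c d A B C \<longleftrightarrow>
    power_triples A \<and> power_triples B \<and> power_triples C \<and>
    A 0 = triple a b c \<and> B 0 = triple a b c \<and> C 0 = triple a b c \<and>
    fst (A 1) = x d c + x c a \<and> fst (rot (B 1)) = x d a + x a b \<and>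
    fst (rot (rot (C 1))) = x d b + x b c"

lemma tetrahedron_spanned:
  assumes abcd: "distinct [a, b, c, d]"
  shows "\<exists>A B C. frame_powers a b c d A B C \<and>
    (\<forall>i\<in>{a, b, c, d}. \<forall>j\<in>{a, b, c, d}. i \<noteq> j \<longrightarrow>
       x i j \<in> power_span A B C \<and> (\<forall>w\<in>power_span A B C. bracket (x i j) w \<in> power_span A B C))"
proof -
  have bcad: "distinct [b, c, a, d]" and cabd: "distinct [c, a, b, d]"
    using abcd by auto
  obtain A where A: "power_triples A" "A 0 = triple a b c" "fst (A 1) = x d c + x c a"
    using powers_tetrahedron[OF abcd] by blast
  obtain A' where A': "power_triples A'" "A' 0 = triple b c a" "fst (A' 1) = x d a + x a b"
    using powers_tetrahedron[OF bcad] by blast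
  obtain A'' where A'': "power_triples A''" "A'' 0 = triple c a b" "fst (A'' 1) = x d b + x b c"
    using powers_tetrahedron[OF cabd] by blast
  \<comment> \<open>The three power sequences live in three frames. \<open>rot\<close> moves the
    frame \<open>a, b, c\<close> to \<open>b, c, a\<close>, so two rotations, respectively one,
    bring \<open>A'\<close> and \<open>A''\<close> back to \<open>a, b, c\<close>, where they can be
    multiplied with \<open>A\<close>.\<close>
  define B where "B n = rot (rot (A' n))" for n
  define C where "C n = rot (A'' n)" for n
  define I where "I = triple a b c"
  have B: "power_triples B" "B 0 = I" "rot (B 1) = A' 1"
    using power_triples_rot[OF power_triples_rot[OF A'(1)]] A'(2)
    by (simp_all add: B_def[abs_def] rot_triple rot_rot_rot I_def)
  have C: "power_triples C" "C 0 = I" "rot (rot (C 1)) = A'' 1"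
    using power_triples_rot[OF A''(1)] A''(2)
    by (simp_all add: C_def[abs_def] rot_triple rot_rot_rot I_def)
  have frame: "frame_powers a b c d A B C"
    using A B C A'(3) A''(3) by (simp add: frame_powers_def I_def)
  have zero: "mul (T 0) (T n) (T n)" if "power_triples T" for T n
    using that by (rule power_triplesD) simp
  have one: "mul (T 1) (T n) (T (Suc n))" if "power_triples T" for T n
    using that by (rule power_triplesD) simp
  have adj: "mul (triple a b c) (A 1) (A 1)" "mul (triple b c a) (A' 1) (A' 1)"
    "mul (triple c a b) (A'' 1) (A'' 1)"
    using zero[OF A(1), of 1] zero[OF A'(1), of 1] zero[OF A''(1), of 1] A(2) A'(2) A''(2) by simp_all
  have "mul (A' 1) (rot (A 1)) (rot (A 1) - triple b c a)"
    using mul_frames[OF abcd adj(1) A(3) adj(2) A'(3)] .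
  from mul_rot[OF mul_rot[OF this]] have BA: "mul (B 1) (A 1) (A 1 - I)"
    by (simp add: rot_diff rot_rot_rot rot_triple B_def I_def)
  have "mul (A'' 1) (rot (A' 1)) (rot (A' 1) - triple c a b)"
    using mul_frames[OF bcad adj(2) A'(3) adj(3) A''(3)] .
  from mul_rot[OF this] have CB: "mul (C 1) (B 1) (B 1 - I)"
    by (simp add: rot_diff rot_triple B_def C_def I_def)
  have AC: "mul (A 1) (C 1) (C 1 - I)"
    using mul_frames[OF cabd adj(3) A''(3) adj(1) A(3)] by (simp add: C_def I_def)
  define S where "S = power_span A B C"
  define W where "W = (\<Union>n. comps (A n) \<union> comps (B n) \<union> comps (C n))"
  \<comment> \<open>Acting with powers 0 and 1 suffices, because every \<open>x i j\<close> already
    lies in their span.\<close>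
  define G where "G = comps I \<union> comps (A 1) \<union> comps (B 1) \<union> comps (C 1)"
  have S_W: "S = span W"
    by (simp add: S_def W_def power_span_def)
  have S: "subspace S"
    by (simp add: S_W)
  have comps_S: "comps (A n) \<subseteq> S" "comps (B n) \<subseteq> S" "comps (C n) \<subseteq> S" for n
    unfolding S_W W_def by (auto intro: span_base)
  have A0: "A 0 = I" using A by (simp add: I_def)
  have self: "bracket g w \<in> S"
    if "power_triples T" "\<And>n. comps (T n) \<subseteq> S" "g \<in> comps (T 0) \<union> comps (T 1)" "w \<in> comps (T n)" for T g w n
    using that(3)
  proof
    assume "g \<in> comps (T 0)"
    then show ?thesis
      using bracket_comps[OF zero[OF that(1)] that(2) S] that(4) by blast
  next
    assume "g \<in> comps (T 1)"
    then show ?thesis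
      using bracket_comps[OF one[OF that(1)] that(2) S] that(4) by blast
  qed
  have other: "bracket g w \<in> S"
    if "power_triples T" "\<And>n. comps (T n) \<subseteq> S" "comps P \<subseteq> S" "mul I P P" "T 0 = I"
      "mul P (T 1) (P - I) \<or> mul P (T 1) (T 1 - I)" "g \<in> comps P" "w \<in> comps (T n)" for T P g w n
    using bracket_powers[OF that(1) S that(2,3)] that(4-) by auto
  have I1: "mul I (A 1) (A 1)" "mul I (B 1) (B 1)" "mul I (C 1) (C 1)"
    using zero[OF A(1), of 1] zero[OF B(1), of 1] zero[OF C(1), of 1] A0 B(2) C(2) by auto
  have GW: "bracket g w \<in> S" if gw: "g \<in> G" "w \<in> W" for g w
  proof -
    obtain n where "w \<in> comps (A n) \<or> w \<in> comps (B n) \<or> w \<in> comps (C n)"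
      using gw(2) by (auto simp: W_def)
    then consider "w \<in> comps (A n)" | "w \<in> comps (B n)" | "w \<in> comps (C n)" by blast
    then show ?thesis
    proof cases
      case 1
      have "bracket g w \<in> S" if "g \<in> comps (B 1)"
        by (rule other[OF A(1) comps_S(1,2) I1(2) A0 _ that 1]) (use BA in blast)
      moreover have "bracket g w \<in> S" if "g \<in> comps (C 1)"
        by (rule other[OF A(1) comps_S(1,3) I1(3) A0 _ that 1]) (use mul_commute[OF AC] in blast)
      moreover have "bracket g w \<in> S" if "g \<in> comps I \<union> comps (A 1)"
        by (rule self[OF A(1) comps_S(1) _ 1]) (use that A0 in simp)
      ultimately show ?thesis
        using gw(1) unfolding G_def by blast
    next
      case 2
      have "bracket g w \<in> S" if "g \<in> comps (A 1)"
        by (rule other[OF B(1) comps_S(2,1) I1(1) B(2) _ that 2]) (use mul_commute[OF BA] in blast)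
      moreover have "bracket g w \<in> S" if "g \<in> comps (C 1)"
        by (rule other[OF B(1) comps_S(2,3) I1(3) B(2) _ that 2]) (use CB in blast)
      moreover have "bracket g w \<in> S" if "g \<in> comps I \<union> comps (B 1)"
        by (rule self[OF B(1) comps_S(2) _ 2]) (use that B(2) in simp)
      ultimately show ?thesis
        using gw(1) unfolding G_def by blast
    next
      case 3
      have "bracket g w \<in> S" if "g \<in> comps (A 1)"
        by (rule other[OF C(1) comps_S(3,1) I1(1) C(2) _ that 3]) (use AC in blast)
      moreover have "bracket g w \<in> S" if "g \<in> comps (B 1)"
        by (rule other[OF C(1) comps_S(3,2) I1(2) C(2) _ that 3]) (use mul_commute[OF CB] in blast)
      moreover have "bracket g w \<in> S" if "g \<in> comps I \<union> comps (C 1)"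
        by (rule self[OF C(1) comps_S(3) _ 3]) (use that C(2) in simp)
      ultimately show ?thesis
        using gw(1) unfolding G_def by blast
    qed
  qed
  have G_S: "G \<subseteq> S"
    using comps_S A0 unfolding G_def by (metis le_sup_iff)
  have gens: "x i j \<in> span G" if ij: "i \<in> {a, b, c, d}" "j \<in> {a, b, c, d}" "i \<noteq> j" for i j
  proof -
    have sub: "subspace (span G)" by simp
    have base: "w \<in> span G" if "w \<in> G" for w using that by (rule span_base)
    have I: "x b c + x c a \<in> span G" "x b c \<in> span G" "x a b + x b c \<in> span G"
      by (rule base, simp add: G_def comps_def I_def triple_def)+
    have ca: "x c a \<in> span G" using span_diff[OF I(1,2)] by simp
    have ab: "x a b \<in> span G" using span_diff[OF I(3,2)] by simp
    have fst_rot: "fst (rot P) \<in> span G" "fst (rot (rot P)) \<in> span G" if "comps P \<subseteq> G" for P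
    proof -
      have "comps P \<subseteq> span G" using that by (auto intro: base)
      then show "fst (rot P) \<in> span G" "fst (rot (rot P)) \<in> span G"
        by (cases P; auto simp: rot_def comps_def intro!: span_add span_diff span_scale)+
    qed
    have "x d c + x c a \<in> span G"
      unfolding A(3)[symmetric] by (rule base) (auto simp: G_def comps_def)
    from span_diff[OF this ca] have dc: "x d c \<in> span G" by simp
    have "x d a + x a b \<in> span G"
      unfolding A'(3)[symmetric] B(3)[symmetric] by (rule fst_rot) (auto simp: G_def)
    from span_diff[OF this ab] have da: "x d a \<in> span G" by simp
    have "x d b + x b c \<in> span G"
      unfolding A''(3)[symmetric] C(3)[symmetric] by (rule fst_rot) (auto simp: G_def)
    from span_diff[OF this I(2)] have db: "x d b \<in> span G" by simp
    have "x p q \<in> span G \<and> x q p \<in> span G" if "x p q \<in> span G" "p \<noteq> q" for p q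
      using that x_swap[of p q] by (simp add: span_neg)
    then have "x a b \<in> span G \<and> x b a \<in> span G" "x b c \<in> span G \<and> x c b \<in> span G"
      "x c a \<in> span G \<and> x a c \<in> span G" "x d a \<in> span G \<and> x a d \<in> span G"
      "x d b \<in> span G \<and> x b d \<in> span G" "x d c \<in> span G \<and> x c d \<in> span G"
      using ab I(2) ca da db dc abcd by auto
    then show ?thesis
      using ij by blast
  qed
  have "span G \<subseteq> S"
    using G_S S by (rule span_minimal)
  then have "x i j \<in> S \<and> (\<forall>w\<in>S. bracket (x i j) w \<in> S)"
    if "i \<in> {a, b, c, d}" "j \<in> {a, b, c, d}" "i \<noteq> j" for i j
    using gens[OF that] bracket_span[OF S GW gens[OF that]] unfolding S_W by blast
  with frame show ?thesis
    unfolding S_def by blast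
qed

end

section \<open>Partial fractions\<close>

lemma poly_eq_0_cofinite:
  fixes W :: "'a::field_char_0 poly"
  assumes "finite X" "\<And>s. s \<notin> X \<Longrightarrow> poly W s = 0"
  shows "W = 0"
proof (rule ccontr)
  assume "W \<noteq> 0"
  then have "finite {s. poly W s = 0}"
    by (rule poly_roots_finite)
  moreover have "UNIV = {s. poly W s = 0} \<union> X"
    using assms(2) by auto
  ultimately have "finite (UNIV :: 'a set)"
    using assms(1) by (metis finite_Un)
  then show False
    by (simp add: infinite_UNIV_char_0)
qed

text \<open>Multiplying by \<open>s^m (1 - s)^l\<close> gives a polynomial \<open>W\<close> with
  infinitely many zeros. If \<open>m > 0\<close>, only the leading coefficient of \<open>q\<close>
  survives in \<open>W\<close> at 0; if \<open>l > 0\<close>, only that of \<open>r\<close> survives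
  at 1. Constants are common to the three summands, so just their sum is determined.\<close>

lemma partial_fractions_unique:
  fixes p q r :: "'a::field_char_0 poly"
  assumes "\<And>s. s \<noteq> 0 \<Longrightarrow> s \<noteq> 1 \<Longrightarrow> poly p s + poly q (1 - 1 / s) + poly r (1 / (1 - s)) = 0"
  shows "degree p = 0" "degree q = 0" "degree r = 0"
    "coeff p 0 + coeff q 0 + coeff r 0 = 0"
proof -
  define m l where "m = degree q" and "l = degree r"
  define Q where "Q = (\<Sum>i\<le>m. smult (coeff q i) ([:-1, 1:] ^ i * [:0, 1:] ^ (m - i)))"
  define R where "R = (\<Sum>i\<le>l. smult (coeff r i) ([:1, -1:] ^ (l - i)))"
  define W where "W = [:0, 1:] ^ m * [:1, -1:] ^ l * p + [:1, -1:] ^ l * Q + [:0, 1:] ^ m * R"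
  have Q: "poly Q s = s ^ m * poly q (1 - 1 / s)" if "s \<noteq> 0" for s
  proof -
    have "(s - 1) ^ i * s ^ (m - i) = s ^ m * (1 - 1 / s) ^ i" if "i \<le> m" for i
    proof -
      have "s ^ m = s ^ i * s ^ (m - i)"
        using that by (simp flip: power_add)
      moreover have "(s - 1) ^ i = s ^ i * (1 - 1 / s) ^ i"
        using \<open>s \<noteq> 0\<close> by (simp flip: power_mult_distrib add: algebra_simps)
      ultimately show ?thesis by simp
    qed
    then show ?thesis
      by (simp add: Q_def poly_sum poly_altdef[of q] m_def sum_distrib_left mult.left_commute)
  qed
  have R: "poly R s = (1 - s) ^ l * poly r (1 / (1 - s))" if "s \<noteq> 1" for s
  proof -
    have "(1 - s) ^ (l - i) = (1 - s) ^ l * (1 / (1 - s)) ^ i" if "i \<le> l" for i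
      using that \<open>s \<noteq> 1\<close> by (simp add: power_diff power_one_over)
    then show ?thesis
      by (simp add: R_def poly_sum poly_altdef[of r] l_def sum_distrib_left mult.left_commute)
  qed
  have "W = 0"
  proof (rule poly_eq_0_cofinite[of "{0, 1}"])
    fix s :: 'a assume "s \<notin> {0, 1}"
    then have s: "s \<noteq> 0" "s \<noteq> 1" by auto
    have "poly W s = s ^ m * (1 - s) ^ l * (poly p s + poly q (1 - 1 / s) + poly r (1 / (1 - s)))"
      by (simp add: W_def Q[OF s(1)] R[OF s(2)] algebra_simps)
    then show "poly W s = 0"
      using assms[OF s] by simp
  qed simp
  then have W: "poly W s = 0" for s by simp
  have m: "m = 0"
  proof (rule ccontr)
    assume "m \<noteq> 0"
    have "poly Q 0 = (\<Sum>i\<le>m. if i = m then coeff q i * (-1) ^ i else 0)"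
      unfolding Q_def poly_sum by (intro sum.cong) auto
    then have "coeff q m = 0"
      using W[of 0] \<open>m \<noteq> 0\<close> by (simp add: W_def power_0_left)
    then have "q = 0"
      by (simp add: m_def)
    then show False
      using \<open>m \<noteq> 0\<close> by (simp add: m_def)
  qed
  have l: "l = 0"
  proof (rule ccontr)
    assume "l \<noteq> 0"
    have "poly R 1 = (\<Sum>i\<le>l. if i = l then coeff r i else 0)"
      unfolding R_def poly_sum by (intro sum.cong) auto
    then have "coeff r l = 0"
      using W[of 1] \<open>l \<noteq> 0\<close> by (simp add: W_def power_0_left)
    then have "r = 0"
      by (simp add: l_def)
    then show False
      using \<open>l \<noteq> 0\<close> by (simp add: l_def)
  qed
  have "p + [:coeff q 0 + coeff r 0:] = 0"
    using \<open>W = 0\<close> m l by (simp add: W_def Q_def R_def add.assoc)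
  then have p: "p = - [:coeff q 0 + coeff r 0:]"
    by (rule eq_neg_iff_add_eq_0[THEN iffD2])
  show "degree p = 0" "degree q = 0" "degree r = 0" "coeff p 0 + coeff q 0 + coeff r 0 = 0"
    using m l by (simp_all add: m_def l_def p)
qed

text \<open>The ring \<open>F[t, 1/t, 1/(1 - t)]\<close>, as functions of \<open>t\<close> away from 0 and 1.\<close>

definition regular :: "('a::field \<Rightarrow> 'a) \<Rightarrow> bool" where
  "regular g \<longleftrightarrow> (\<exists>p q r. \<forall>s. s \<noteq> 0 \<longrightarrow> s \<noteq> 1 \<longrightarrow>
     g s = poly p s + poly q (1 - 1 / s) + poly r (1 / (1 - s)))"

lemma regularI:
  "(\<And>s. s \<noteq> 0 \<Longrightarrow> s \<noteq> 1 \<Longrightarrow> g s = poly p s + poly q (1 - 1 / s) + poly r (1 / (1 - s))) \<Longrightarrow> regular g"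
  unfolding regular_def by blast

lemma regular_cong: "(\<And>s. s \<noteq> 0 \<Longrightarrow> s \<noteq> 1 \<Longrightarrow> g s = g' s) \<Longrightarrow> regular g \<longleftrightarrow> regular g'"
  by (simp add: regular_def)

lemma regular_add:
  assumes "regular g" "regular g'"
  shows "regular (\<lambda>s. g s + g' s)"
proof -
  obtain p q r p' q' r' where *: "\<And>s. s \<noteq> 0 \<Longrightarrow> s \<noteq> 1 \<Longrightarrow> g s = poly p s + poly q (1 - 1 / s) + poly r (1 / (1 - s))"
    "\<And>s. s \<noteq> 0 \<Longrightarrow> s \<noteq> 1 \<Longrightarrow> g' s = poly p' s + poly q' (1 - 1 / s) + poly r' (1 / (1 - s))"
    using assms unfolding regular_def by metis
  show ?thesis
    by (rule regularI[of _ "p + p'" "q + q'" "r + r'"]) (simp add: *)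
qed

lemma regular_uminus:
  assumes "regular g"
  shows "regular (\<lambda>s. - g s)"
proof -
  obtain p q r where *: "\<And>s. s \<noteq> 0 \<Longrightarrow> s \<noteq> 1 \<Longrightarrow> g s = poly p s + poly q (1 - 1 / s) + poly r (1 / (1 - s))"
    using assms unfolding regular_def by metis
  show ?thesis
    by (rule regularI[of _ "- p" "- q" "- r"]) (simp add: *)
qed

lemma regular_poly:
  "regular (poly p)" "regular (\<lambda>s. poly p (1 - 1 / s))" "regular (\<lambda>s. poly p (1 / (1 - s)))"
  by (rule regularI[of _ p 0 0] regularI[of _ 0 p 0] regularI[of _ 0 0 p]; simp)+

text \<open>Needed to divide by the determinant of the final change of coordinates. With
  \<open>u = 1/(1 - s)\<close> and \<open>v = 1 - 1/s\<close>, the rules \<open>u s = u - 1\<close>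
  and \<open>u v = v - 1\<close> remove mixed products.\<close>

lemma regular_mult_inverse:
  fixes g :: "'a::field \<Rightarrow> 'a"
  assumes "regular g"
  shows "regular (\<lambda>s. 1 / (1 - s) * g s)"
proof -
  obtain p q r where g: "\<And>s. s \<noteq> 0 \<Longrightarrow> s \<noteq> 1 \<Longrightarrow> g s = poly p s + poly q (1 - 1 / s) + poly r (1 / (1 - s))"
    using assms unfolding regular_def by metis
  have const: "regular (\<lambda>s. c * (1 / (1 - s)))" for c :: 'a
    by (rule regularI[of _ 0 0 "[:0, c:]"]) simp
  have p: "regular (\<lambda>s. 1 / (1 - s) * poly p s)" for p :: "'a poly"
  proof (induction p)
    case (pCons c p)
    have "regular (\<lambda>s. c * (1 / (1 - s)) + (1 / (1 - s) * poly p s + poly (- p) s))"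
      by (intro regular_add const pCons regular_poly)
    moreover have "c * (1 / (1 - s)) + (1 / (1 - s) * poly p s + poly (- p) s)
      = 1 / (1 - s) * poly (pCons c p) s" if "s \<noteq> 1" for s
    proof -
      have "1 / (1 - s) * s = 1 / (1 - s) - 1"
        using that by (simp add: field_simps)
      then show ?thesis
        by (simp only: poly_pCons distrib_left mult.assoc[symmetric] left_diff_distrib poly_minus)
          (simp add: mult.commute)
    qed
    ultimately show ?case
      by (subst regular_cong[symmetric]) auto
  qed (rule regularI[of _ 0 0 0], simp)
  have q: "regular (\<lambda>s. 1 / (1 - s) * poly q (1 - 1 / s))"
  proof (cases q)
    case (pCons c q')
    have "regular (\<lambda>s. c * (1 / (1 - s)) + poly ([:-1, 1:] * q') (1 - 1 / s))"
      by (intro regular_add const regular_poly)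
    moreover have "c * (1 / (1 - s)) + poly ([:-1, 1:] * q') (1 - 1 / s)
      = 1 / (1 - s) * poly (pCons c q') (1 - 1 / s)" if "s \<noteq> 1" "s \<noteq> 0" for s
    proof -
      define u v where "u = 1 / (1 - s)" and "v = 1 - 1 / s"
      have "u * v = v - 1"
        using that by (simp add: u_def v_def field_simps)
      then have "c * u + (v - 1) * poly q' v = u * (c + v * poly q' v)"
        by (simp add: distrib_left mult.commute flip: mult.assoc)
      then show ?thesis
        by (simp add: u_def v_def algebra_simps)
    qed
    ultimately show ?thesis
      unfolding pCons by (subst regular_cong[symmetric]) auto
  qed
  have r: "regular (\<lambda>s. 1 / (1 - s) * poly r (1 / (1 - s)))"
    using regular_poly(3)[of "pCons 0 r"] by simp
  have "regular (\<lambda>s. 1 / (1 - s) * poly p s + 1 / (1 - s) * poly q (1 - 1 / s) + 1 / (1 - s) * poly r (1 / (1 - s)))"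
    by (intro regular_add p q r)
  then show ?thesis
    by (rule regular_cong[THEN iffD1, rotated]) (simp add: g distrib_left)
qed

section \<open>Evaluation homomorphisms\<close>

definition sl2_scale :: "'f::field \<Rightarrow> 'f \<times> 'f \<times> 'f \<Rightarrow> 'f \<times> 'f \<times> 'f" where
  "sl2_scale c u = (case u of (p, q, r) \<Rightarrow> (c * p, c * q, c * r))"

text \<open>\<open>(p, q, r)\<close> are the coordinates of \<open>p e + q h + r f\<close>, with
  \<open>[h, e] = 2e\<close>, \<open>[h, f] = -2f\<close>, \<open>[e, f] = -4h\<close>.\<close>

definition sl2_bracket :: "'f::field \<times> 'f \<times> 'f \<Rightarrow> 'f \<times> 'f \<times> 'f \<Rightarrow> 'f \<times> 'f \<times> 'f" where
  "sl2_bracket u v = (case (u, v) of ((p, q, r), (p', q', r')) \<Rightarrow>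
     (2 * (q * p' - p * q'), - 4 * (p * r' - r * p'), - 2 * (q * r' - r * q')))"

interpretation sl2: lie_algebra_char_0 "sl2_scale :: 'f::field_char_0 \<Rightarrow> _" sl2_bracket
  by unfold_locales
    (auto simp: sl2_scale_def sl2_bracket_def zero_prod_def algebra_simps split: prod.splits)

text \<open>Minus the determinant of the traceless matrix with these coordinates. Its adjoint action
  has eigenvalues 0 and plus or minus twice a square root of this number, whence the cubic identity
  below.\<close>

definition sl2_disc :: "'f::field \<times> 'f \<times> 'f \<Rightarrow> 'f" where
  "sl2_disc u = (case u of (p, q, r) \<Rightarrow> q * q - 4 * p * r)"

lemma sl2_cubic:
  assumes "sl2_disc u = 1"
  shows "sl2_bracket u (sl2_bracket u (sl2_bracket u v)) = sl2_scale 4 (sl2_bracket u v)"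
proof -
  have "sl2_bracket u (sl2_bracket u (sl2_bracket u v)) = sl2_scale (4 * sl2_disc u) (sl2_bracket u v)"
    by (cases u; cases v) (simp add: sl2_bracket_def sl2_scale_def sl2_disc_def algebra_simps)
  then show ?thesis by (simp add: assms)
qed

lemma sl2_centralizer:
  fixes u v :: "'f::field_char_0 \<times> 'f \<times> 'f"
  assumes "sl2_bracket u v = 0" "u \<noteq> 0"
  shows "\<exists>c. v = sl2_scale c u"
proof -
  obtain p q r p' q' r' where uv: "u = (p, q, r)" "v = (p', q', r')"
    by (metis prod.exhaust)
  have eq: "p * q' = p' * q" "p * r' = p' * r" "q * p' = q' * p" "q * r' = q' * r"
      "r * p' = r' * p" "r * q' = r' * q"
    using assms(1) by (auto simp: uv sl2_bracket_def zero_prod_def mult.commute)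
  have scale: "\<exists>c. v = sl2_scale c u"
    if "z \<noteq> 0" "z * p' = z' * p" "z * q' = z' * q" "z * r' = z' * r" for z z'
  proof -
    have "w' = z' / z * w" if "z * w' = z' * w" for w w'
      using that \<open>z \<noteq> 0\<close> by (metis nonzero_mult_div_cancel_left times_divide_eq_left)
    with that show ?thesis
      by (intro exI[of _ "z' / z"]) (auto simp only: uv sl2_scale_def prod.case)
  qed
  have "p \<noteq> 0 \<or> q \<noteq> 0 \<or> r \<noteq> 0"
    using assms(2) by (auto simp: uv zero_prod_def)
  then show ?thesis
    using eq by (auto intro: scale[of p p'] scale[of q q'] scale[of r r'])
qed

text \<open>
  The triangle \<open>a, b, c\<close> goes to the equitable basis \<open>x, y, z\<close>, and \<open>x d c\<close>, \<open>x d a\<close>, \<open>x d b\<close> go to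
  \<open>s y + (s - 1) z\<close>, \<open>s' z + (s' - 1) x\<close>, \<open>s'' x + (s'' - 1) y\<close> with \<open>s' = 1 - 1/s\<close>, \<open>s'' = 1/(1 - s)\<close>
  (the Hartwig--Terwilliger map into the three-point loop algebra, evaluated at \<open>t = s\<close>).
\<close>

definition half_image :: "'i \<Rightarrow> 'i \<Rightarrow> 'i \<Rightarrow> 'i \<Rightarrow> 'f::field \<Rightarrow> 'i \<Rightarrow> 'i \<Rightarrow> 'f \<times> 'f \<times> 'f" where
  "half_image a b c d s i j =
    (if (i, j) = (a, b) then (0, - 1, 1)
     else if (i, j) = (b, c) then (0, 1, 0)
     else if (i, j) = (c, a) then (1, - 1, 0)
     else if (i, j) = (d, c) then (s - 1, 1, 0)
     else if (i, j) = (d, a) then (1 - 1 / s, 2 / s - 1, - 1 / s)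
     else if (i, j) = (d, b) then (0, - 1, 1 / (1 - s))
     else (0, 0, 0))"

definition gen_image :: "'i \<Rightarrow> 'i \<Rightarrow> 'i \<Rightarrow> 'i \<Rightarrow> 'f::field \<Rightarrow> 'i \<Rightarrow> 'i \<Rightarrow> 'f \<times> 'f \<times> 'f" where
  "gen_image a b c d s i j = half_image a b c d s i j - half_image a b c d s j i"

lemma gen_image_simps:
  assumes "distinct [a, b, c, d]"
  shows "gen_image a b c d s a b = (0, - 1, 1)" "gen_image a b c d s b a = (0, 1, - 1)"
    "gen_image a b c d s b c = (0, 1, 0)" "gen_image a b c d s c b = (0, - 1, 0)"
    "gen_image a b c d s c a = (1, - 1, 0)" "gen_image a b c d s a c = (- 1, 1, 0)"
    "gen_image a b c d s d c = (s - 1, 1, 0)" "gen_image a b c d s c d = (1 - s, - 1, 0)"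
    "gen_image a b c d s d a = (1 - 1 / s, 2 / s - 1, - 1 / s)"
    "gen_image a b c d s a d = (1 / s - 1, 1 - 2 / s, 1 / s)"
    "gen_image a b c d s d b = (0, - 1, 1 / (1 - s))"
    "gen_image a b c d s b d = (0, 1, - 1 / (1 - s))"
proof -
  have "a \<noteq> b" "b \<noteq> a" "a \<noteq> c" "c \<noteq> a" "a \<noteq> d" "d \<noteq> a" "b \<noteq> c" "c \<noteq> b" "b \<noteq> d" "d \<noteq> b"
    "c \<noteq> d" "d \<noteq> c"
    using assms by auto
  note this [simp]
  show "gen_image a b c d s a b = (0, - 1, 1)" "gen_image a b c d s b a = (0, 1, - 1)"
    "gen_image a b c d s b c = (0, 1, 0)" "gen_image a b c d s c b = (0, - 1, 0)"
    "gen_image a b c d s c a = (1, - 1, 0)" "gen_image a b c d s a c = (- 1, 1, 0)"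
    "gen_image a b c d s d c = (s - 1, 1, 0)" "gen_image a b c d s c d = (1 - s, - 1, 0)"
    "gen_image a b c d s d a = (1 - 1 / s, 2 / s - 1, - 1 / s)"
    "gen_image a b c d s a d = (1 / s - 1, 1 - 2 / s, 1 / s)"
    "gen_image a b c d s d b = (0, - 1, 1 / (1 - s))"
    "gen_image a b c d s b d = (0, 1, - 1 / (1 - s))"
    by (simp_all add: gen_image_def half_image_def)
qed

lemma sl2_disc_gen_image:
  fixes s :: "'f::field_char_0"
  assumes "distinct [a, b, c, d]" "UNIV = {a, b, c, d}" "s \<noteq> 0" "s \<noteq> 1" "i \<noteq> j"
  shows "sl2_disc (gen_image a b c d s i j) = 1"
proof -
  have all: "i = a \<or> i = b \<or> i = c \<or> i = d" for i
    using assms(2) by auto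
  show ?thesis
    using all[of i] all[of j] assms(3-5)
    by (elim disjE) (simp_all add: gen_image_simps[OF assms(1)] sl2_disc_def field_simps)
qed

lemma tetrahedron_gen_image:
  fixes s :: "'f::field_char_0"
  assumes abcd: "distinct [a, b, c, d]" "UNIV = {a, b, c, d}" and s: "s \<noteq> 0" "s \<noteq> 1"
  shows "tetrahedron sl2_scale sl2_bracket (gen_image a b c d s)"
proof
  have all: "i = a \<or> i = b \<or> i = c \<or> i = d" for i
    using abcd(2) by auto
  fix h i j k
  show "i \<noteq> j \<Longrightarrow> gen_image a b c d s i j + gen_image a b c d s j i = 0"
    by (simp add: gen_image_def)
  show "sl2_bracket (gen_image a b c d s i j) (gen_image a b c d s j k) =
      sl2_scale 2 (gen_image a b c d s i j) + sl2_scale 2 (gen_image a b c d s j k)"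
    if "distinct [i, j, k]"
    using all[of i] all[of j] all[of k] that s
    by (elim disjE; simp; simp add: gen_image_simps[OF abcd(1)] sl2_bracket_def sl2_scale_def;
        (simp add: divide_simps; simp add: algebra_simps)?)
  show "sl2_bracket (gen_image a b c d s i j) (sl2_bracket (gen_image a b c d s i j)
        (sl2_bracket (gen_image a b c d s i j) (gen_image a b c d s k h))) =
      sl2_scale 4 (sl2_bracket (gen_image a b c d s i j) (gen_image a b c d s k h))"
    if "distinct [h, i, j, k]"
    using that by (intro sl2_cubic sl2_disc_gen_image[OF abcd s]) auto
qed

section \<open>Homomorphisms to sl2 and polynomial combinations of powers\<close>

context lie_algebra_char_0
begin

definition poly_comb :: "(nat \<Rightarrow> 'v) \<Rightarrow> 'f poly \<Rightarrow> 'v" where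
  "poly_comb g p = (\<Sum>n\<le>degree p. scale (coeff p n) (g n))"

lemma poly_comb_eq_sum:
  assumes "degree p \<le> N"
  shows "poly_comb g p = (\<Sum>n\<le>N. scale (coeff p n) (g n))"
  unfolding poly_comb_def
  by (rule sum.mono_neutral_left) (use assms in \<open>auto simp: coeff_eq_0\<close>)

lemma poly_comb_add: "poly_comb g (p + q) = poly_comb g p + poly_comb g q"
proof -
  let ?N = "max (degree p) (degree q)"
  have "poly_comb g (p + q) = (\<Sum>n\<le>?N. scale (coeff (p + q) n) (g n))"
    by (rule poly_comb_eq_sum) (rule degree_add_le_max)
  then show ?thesis
    by (simp add: poly_comb_eq_sum[of p ?N] poly_comb_eq_sum[of q ?N] scale_left_distrib sum.distrib)
qed

lemma poly_comb_smult: "poly_comb g (smult c p) = scale c (poly_comb g p)"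
  by (subst poly_comb_eq_sum[of _ "degree p"]) (simp_all add: poly_comb_def scale_sum_right)

lemma poly_comb_0 [simp]: "poly_comb g 0 = 0"
  by (simp add: poly_comb_def)

lemma poly_comb_monom: "poly_comb g (monom 1 n) = g n"
proof -
  have "poly_comb g (monom 1 n) = (\<Sum>m\<le>n. if m = n then g m else 0)"
    unfolding poly_comb_def degree_monom_eq[OF one_neq_zero] by (intro sum.cong) auto
  then show ?thesis by simp
qed

lemma poly_comb_const: "degree p = 0 \<Longrightarrow> poly_comb g p = scale (coeff p 0) (g 0)"
  by (simp add: poly_comb_def)

definition sl2_hom :: "('v \<Rightarrow> 'f \<times> 'f \<times> 'f) \<Rightarrow> bool" where
  "sl2_hom \<rho> \<longleftrightarrow> (\<forall>a b. \<rho> (a + b) = \<rho> a + \<rho> b) \<and> (\<forall>c a. \<rho> (scale c a) = sl2_scale c (\<rho> a)) \<and>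
     (\<forall>a b. \<rho> (bracket a b) = sl2_bracket (\<rho> a) (\<rho> b))"

lemma sl2_homD:
  assumes "sl2_hom \<rho>"
  shows "\<rho> (a + b) = \<rho> a + \<rho> b" "\<rho> (scale c a) = sl2_scale c (\<rho> a)"
    "\<rho> (bracket a b) = sl2_bracket (\<rho> a) (\<rho> b)" "\<rho> 0 = 0" "\<rho> (- a) = - \<rho> a" "\<rho> (a - b) = \<rho> a - \<rho> b"
proof -
  show add: "\<rho> (a + b) = \<rho> a + \<rho> b" for a b
    using assms by (simp add: sl2_hom_def)
  show "\<rho> (scale c a) = sl2_scale c (\<rho> a)" "\<rho> (bracket a b) = sl2_bracket (\<rho> a) (\<rho> b)"
    using assms by (simp_all add: sl2_hom_def)
  show zero: "\<rho> 0 = 0"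
    using add[of 0 0] by simp
  show minus: "\<rho> (- a) = - \<rho> a" for a
    using add[of "- a" a] by (simp add: zero eq_neg_iff_add_eq_0)
  show "\<rho> (a - b) = \<rho> a - \<rho> b"
    using add[of a "- b"] by (simp add: minus)
qed

text \<open>Says that \<open>\<rho> (u \<otimes> p) = c \<rho> u\<close>: the homomorphism evaluates
  the tensor factor \<open>p\<close> at \<open>c\<close>.\<close>

definition eigentriple :: "('v \<Rightarrow> 'f \<times> 'f \<times> 'f) \<Rightarrow> 'f \<Rightarrow> 'v \<times> 'v \<times> 'v \<Rightarrow> 'v \<times> 'v \<times> 'v \<Rightarrow> bool" where
  "eigentriple \<rho> c I P \<longleftrightarrow> \<rho> (fst P) = sl2_scale c (\<rho> (fst I)) \<and>
     \<rho> (fst (snd P)) = sl2_scale c (\<rho> (fst (snd I))) \<and> \<rho> (snd (snd P)) = sl2_scale c (\<rho> (snd (snd I)))"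

lemma eigentriple_rot:
  assumes "sl2_hom \<rho>" "eigentriple \<rho> c I P"
  shows "eigentriple \<rho> c (rot I) (rot P)"
  using assms(2) unfolding eigentriple_def
  by (cases I; cases P)
    (simp add: rot_def sl2_homD[OF assms(1)] sl2.scale_right_distrib sl2.scale_right_diff_distrib
      mult.commute)

text \<open>The other two components arise from the first by lowering with \<open>f\<close>, which
  \<open>\<rho>\<close> respects.\<close>

lemma eigentripleI:
  assumes hom: "sl2_hom \<rho>" and I: "mul I I I" and P: "mul I P P"
    and E: "\<rho> (fst P) = sl2_scale c (\<rho> (fst I))"
  shows "eigentriple \<rho> c I P"
proof -
  obtain e h f E H F where eq: "I = (e, h, f)" "P = (E, H, F)"
    by (metis prod.exhaust)
  note hom = sl2_homD[OF hom]
  have I': "bracket f e = scale 4 h" "bracket f h = scale 2 f"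
    and P': "bracket f E = scale 4 H" "bracket f H = scale 2 F"
    using I P by (auto simp: eq mul_def)
  have H: "\<rho> H = sl2_scale c (\<rho> h)"
  proof -
    have "sl2_scale 4 (\<rho> H) = sl2_scale c (\<rho> (bracket f e))"
      using arg_cong[OF P'(1), of \<rho>] E by (simp add: hom eq sl2.bracket_scale_right)
    then have "sl2_scale 4 (\<rho> H) = sl2_scale 4 (sl2_scale c (\<rho> h))"
      by (simp add: I' hom mult.commute)
    then show ?thesis
      by (rule sl2.scale_left_imp_eq[rotated]) simp
  qed
  have "sl2_scale 2 (\<rho> F) = sl2_scale c (\<rho> (bracket f h))"
    using arg_cong[OF P'(2), of \<rho>] H by (simp add: hom sl2.bracket_scale_right)
  then have "sl2_scale 2 (\<rho> F) = sl2_scale 2 (sl2_scale c (\<rho> f))"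
    by (simp add: I' hom mult.commute)
  then have "\<rho> F = sl2_scale c (\<rho> f)"
    by (rule sl2.scale_left_imp_eq[rotated]) simp
  with H E show ?thesis
    by (simp add: eigentriple_def eq)
qed

lemma eigentriple_powers:
  assumes hom: "sl2_hom \<rho>" and T: "power_triples T" and one: "eigentriple \<rho> c (T 0) (T 1)"
  shows "eigentriple \<rho> (c ^ n) (T 0) (T n)"
proof (induction n)
  case 0
  then show ?case by (simp add: eigentriple_def)
next
  case (Suc n)
  have I: "mul (T 0) (T n) (T n)" for n
    using T by (rule power_triplesD) simp
  show ?case
  proof (rule eigentripleI[OF hom I I])
    have "mul (T 1) (T n) (T (Suc n))"
      using T by (rule power_triplesD) simp
    then have "bracket (fst (snd (T 1))) (fst (T n)) = scale 2 (fst (T (Suc n)))"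
      by (auto simp: mul_def split: prod.splits)
    then have "sl2_scale 2 (\<rho> (fst (T (Suc n)))) = \<rho> (bracket (fst (snd (T 1))) (fst (T n)))"
      by (simp add: sl2_homD[OF hom])
    also have "\<dots> = sl2_scale (c ^ Suc n) (\<rho> (bracket (fst (snd (T 0))) (fst (T 0))))"
      using one Suc
      by (simp add: eigentriple_def sl2_homD[OF hom] sl2.bracket_scale_left sl2.bracket_scale_right
          mult.commute)
    also have "bracket (fst (snd (T 0))) (fst (T 0)) = scale 2 (fst (T 0))"
      using I[of 0] by (auto simp: mul_def split: prod.splits)
    finally have "sl2_scale 2 (\<rho> (fst (T (Suc n)))) = sl2_scale 2 (sl2_scale (c ^ Suc n) (\<rho> (fst (T 0))))"
      by (simp add: sl2_homD[OF hom] mult.commute)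
    then show "\<rho> (fst (T (Suc n))) = sl2_scale (c ^ Suc n) (\<rho> (fst (T 0)))"
      by (rule sl2.scale_left_imp_eq[rotated]) simp
  qed
qed

lemma hom_poly_comb:
  assumes hom: "sl2_hom \<rho>" and g: "\<And>n. \<rho> (g n) = sl2_scale (c ^ n) v"
  shows "\<rho> (poly_comb g p) = sl2_scale (poly p c) v"
proof -
  have "\<rho> (sum t X) = (\<Sum>n\<in>X. \<rho> (t n))" if "finite X" for t :: "nat \<Rightarrow> 'v" and X
    using that by (induction rule: finite_induct) (simp_all add: sl2_homD[OF hom])
  then show ?thesis
    by (simp add: poly_comb_def sl2_homD[OF hom] g poly_altdef sl2.scale_sum_left)
qed

text \<open>Stands for \<open>e \<otimes> p(t) + h \<otimes> q(t) + f \<otimes> r(t)\<close> when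
  \<open>T n\<close> belongs to \<open>t^n\<close>.\<close>

definition triple_comb :: "(nat \<Rightarrow> 'v \<times> 'v \<times> 'v) \<Rightarrow> 'f poly \<Rightarrow> 'f poly \<Rightarrow> 'f poly \<Rightarrow> 'v" where
  "triple_comb T p q r = poly_comb (\<lambda>n. fst (T n)) p + poly_comb (\<lambda>n. fst (snd (T n))) q
     + poly_comb (\<lambda>n. snd (snd (T n))) r"

lemma hom_triple_comb:
  assumes hom: "sl2_hom \<rho>" and T: "power_triples T" and one: "eigentriple \<rho> c (T 0) (T 1)"
    and std: "\<rho> (fst (T 0)) = (1, 0, 0)" "\<rho> (fst (snd (T 0))) = (0, 1, 0)" "\<rho> (snd (snd (T 0))) = (0, 0, 1)"
  shows "\<rho> (triple_comb T p q r) = (poly p c, poly q c, poly r c)"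
proof -
  have "eigentriple \<rho> (c ^ n) (T 0) (T n)" for n
    using hom T one by (rule eigentriple_powers)
  then have *: "\<rho> (fst (T n)) = sl2_scale (c ^ n) (1, 0, 0)" "\<rho> (fst (snd (T n))) = sl2_scale (c ^ n) (0, 1, 0)"
    "\<rho> (snd (snd (T n))) = sl2_scale (c ^ n) (0, 0, 1)" for n
    using std by (auto simp: eigentriple_def)
  show ?thesis
    unfolding triple_comb_def sl2_homD(1)[OF hom] hom_poly_comb[OF hom *(1)] hom_poly_comb[OF hom *(2)]
      hom_poly_comb[OF hom *(3)]
    by (simp add: sl2_scale_def)
qed

lemma power_span_triple_comb:
  assumes "w \<in> power_span A B C"
  shows "\<exists>p q r p' q' r' p'' q'' r''.
    w = triple_comb A p q r + triple_comb B p' q' r' + triple_comb C p'' q'' r''"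
proof -
  define V where "V = {w. \<exists>p q r p' q' r' p'' q'' r''.
    w = triple_comb A p q r + triple_comb B p' q' r' + triple_comb C p'' q'' r''}"
  have VI: "triple_comb A p q r + triple_comb B p' q' r' + triple_comb C p'' q'' r'' \<in> V"
    for p q r p' q' r' p'' q'' r''
    unfolding V_def by blast
  have add: "triple_comb T p q r + triple_comb T p' q' r' = triple_comb T (p + p') (q + q') (r + r')"
    for T p q r p' q' r'
    by (simp add: triple_comb_def poly_comb_add algebra_simps)
  have scale: "scale c (triple_comb T p q r) = triple_comb T (smult c p) (smult c q) (smult c r)"
    for c T p q r
    by (simp add: triple_comb_def poly_comb_smult scale_right_distrib)
  have zero: "triple_comb T 0 0 0 = 0" for T
    by (simp add: triple_comb_def)
  have V: "subspace V"
  proof (rule subspaceI)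
    show "0 \<in> V"
      using VI[of 0 0 0 0 0 0 0 0 0] by (simp add: zero)
    fix w w' c assume "w \<in> V"
    then obtain p q r p' q' r' p'' q'' r''
      where w: "w = triple_comb A p q r + triple_comb B p' q' r' + triple_comb C p'' q'' r''"
      unfolding V_def by blast
    show "scale c w \<in> V"
      unfolding w scale_right_distrib scale by (rule VI)
    assume "w' \<in> V"
    then obtain u v t u' v' t' u'' v'' t''
      where w': "w' = triple_comb A u v t + triple_comb B u' v' t' + triple_comb C u'' v'' t''"
      unfolding V_def by blast
    have "w + w' = (triple_comb A p q r + triple_comb A u v t) + (triple_comb B p' q' r' + triple_comb B u' v' t')
        + (triple_comb C p'' q'' r'' + triple_comb C u'' v'' t'')"
      unfolding w w' by (simp add: algebra_simps)
    then show "w + w' \<in> V"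
      unfolding add by (simp add: VI)
  qed
  have basis: "\<exists>p q r. w = triple_comb T p q r" if "w \<in> comps (T n)" for w T n
  proof -
    have "triple_comb T (monom 1 n) 0 0 = fst (T n)" "triple_comb T 0 (monom 1 n) 0 = fst (snd (T n))"
      "triple_comb T 0 0 (monom 1 n) = snd (snd (T n))"
      by (simp_all add: triple_comb_def poly_comb_monom)
    with that show ?thesis
      unfolding comps_def by (elim insertE) (metis | simp)+
  qed
  have "comps (A n) \<union> comps (B n) \<union> comps (C n) \<subseteq> V" for n
  proof -
    have "w \<in> V" if "w \<in> comps (A n)" for w
      using basis[of w A n] that VI[of _ _ _ 0 0 0 0 0 0] by (auto simp: zero)
    moreover have "w \<in> V" if "w \<in> comps (B n)" for w
      using basis[of w B n] that VI[of 0 0 0 _ _ _ 0 0 0] by (auto simp: zero)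
    moreover have "w \<in> V" if "w \<in> comps (C n)" for w
      using basis[of w C n] that VI[of 0 0 0 0 0 0] by (auto simp: zero)
    ultimately show ?thesis by blast
  qed
  then have "power_span A B C \<subseteq> V"
    unfolding power_span_def by (intro span_minimal V) blast
  then show ?thesis
    using assms unfolding V_def by blast
qed

end

section \<open>Joint evaluation of the tetrahedron algebra and the decomposition\<close>

interpretation tetra: tetrahedron "tet_scale :: 'f::field_char_0 \<Rightarrow> _" tet_bracket tet_x
  by unfold_locales (use tet_x_rel_i tet_x_rel_ii tet_x_rel_iii in blast)+

lemma tet_induct [case_names gen zero add scale bracket]:
  assumes "\<And>i j. i \<noteq> j \<Longrightarrow> P (tet_x i j)" and "P 0" and "\<And>a b. P a \<Longrightarrow> P b \<Longrightarrow> P (a + b)"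
    and "\<And>c a. P a \<Longrightarrow> P (tet_scale c a)" and "\<And>a b. P a \<Longrightarrow> P b \<Longrightarrow> P (tet_bracket a b)"
  shows "P (a :: 'f::field tet)"
proof -
  have "P (abs_tet s)" for s
  proof (induction s)
    case (Gen g)
    obtain i j where "i \<noteq> j" "g = Abs_tet_gen (i, j)"
      by (cases g) auto
    then show ?case
      using assms(1) by (simp flip: tet_x.abs_eq)
  next
    case Zero
    then show ?case
      using assms(2) by (simp flip: zero_tet.abs_eq)
  qed (use assms in \<open>simp_all flip: plus_tet.abs_eq tet_scale.abs_eq tet_bracket.abs_eq\<close>)
  then show ?thesis
    by (metis Quotient3_abs_rep[OF Quotient3_tet])
qed

lemma index_UNIV:
  fixes a b c d :: 4
  assumes "distinct [a, b, c, d]"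
  shows "UNIV = {a, b, c, d}"
proof -
  have "card {a, b, c, d} = CARD(4)"
    using assms by auto
  then show ?thesis
    by (metis card_subset_eq finite_class.finite_UNIV subset_UNIV)
qed

text \<open>Membership in the span alone is not inductive at brackets. Stabilising the span is, by
  the derivation rule, and together with membership it passes from the generators to
  everything.\<close>

lemma tet_power_span:
  assumes "distinct [a, b, c, d]"
  shows "\<exists>A B C. tetra.frame_powers a b c d A B C \<and> tetra.power_span A B C = (UNIV :: 'f::field_char_0 tet set)"
proof -
  obtain A B C :: "nat \<Rightarrow> 'f tet \<times> 'f tet \<times> 'f tet" where frame: "tetra.frame_powers a b c d A B C"
    and x: "\<And>i j. i \<noteq> j \<Longrightarrow> tet_x i j \<in> tetra.power_span A B C \<and>
       (\<forall>w\<in>tetra.power_span A B C. tet_bracket (tet_x i j) w \<in> tetra.power_span A B C)"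
    using tetra.tetrahedron_spanned[OF assms] unfolding index_UNIV[OF assms, symmetric] by blast
  let ?S = "tetra.power_span A B C"
  have S: "tet.subspace ?S"
    by (simp add: tetra.power_span_def)
  have "w \<in> ?S \<and> (\<forall>u\<in>?S. tet_bracket w u \<in> ?S)" for w
  proof (induction w rule: tet_induct)
    case (bracket v w)
    have "tet_bracket (tet_bracket v w) u
        = tet_bracket v (tet_bracket w u) - tet_bracket w (tet_bracket v u)" for u
      using tetra.bracket_derivation[of v w u] by simp
    then show ?case
      using bracket S by (simp add: tet.subspace_diff)
  qed (use x S in \<open>auto simp: tet.bracket_add_left tet.bracket_scale_left tet.subspace_0 tet.subspace_add tet.subspace_scale\<close>)
  then show ?thesis
    using frame by blast
qed

definition evaluation :: "4 \<Rightarrow> 4 \<Rightarrow> 4 \<Rightarrow> 4 \<Rightarrow> 'f::field_char_0 \<Rightarrow> 'f tet \<Rightarrow> 'f \<times> 'f \<times> 'f" where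
  "evaluation a b c d s = (SOME \<rho>. tetra.sl2_hom \<rho> \<and> (\<forall>i j. i \<noteq> j \<longrightarrow> \<rho> (tet_x i j) = gen_image a b c d s i j))"

lemma evaluation:
  fixes s :: "'f::field_char_0"
  assumes "distinct [a, b, c, d]" "s \<noteq> 0" "s \<noteq> 1"
  shows "tetra.sl2_hom (evaluation a b c d s)"
    and "i \<noteq> j \<Longrightarrow> evaluation a b c d s (tet_x i j) = gen_image a b c d s i j"
proof -
  interpret img: tetrahedron sl2_scale sl2_bracket "gen_image a b c d s"
    using assms by (intro tetrahedron_gen_image index_UNIV) auto
  have "\<exists>\<rho>. tetra.sl2_hom \<rho> \<and> (\<forall>i j. i \<noteq> j \<longrightarrow> \<rho> (tet_x i j) = gen_image a b c d s i j)"
    using ex1_implies_ex[OF sl2.tet_universal[OF img.x_add_swap img.x_adjacent img.x_opposite]]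
    unfolding tetra.sl2_hom_def by auto
  from someI_ex[OF this]
  show "tetra.sl2_hom (evaluation a b c d s)"
    and "i \<noteq> j \<Longrightarrow> evaluation a b c d s (tet_x i j) = gen_image a b c d s i j"
    unfolding evaluation_def by auto
qed

lemma evaluation_triple_comb:
  fixes s :: "'f::field_char_0"
  assumes abcd: "distinct [a, b, c, d]" and frame: "tetra.frame_powers a b c d A B C"
    and s: "s \<noteq> 0" "s \<noteq> 1"
  shows "evaluation a b c d s (tetra.triple_comb A p q r) = (poly p s, poly q s, poly r s)"
    and "evaluation a b c d s (tetra.triple_comb B p q r)
      = (poly p (1 - 1 / s), poly q (1 - 1 / s), poly r (1 - 1 / s))"
    and "evaluation a b c d s (tetra.triple_comb C p q r)
      = (poly p (1 / (1 - s)), poly q (1 / (1 - s)), poly r (1 / (1 - s)))"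
proof -
  let ?I = "tetra.triple a b c :: 'f tet \<times> 'f tet \<times> 'f tet"
  define \<rho> where "\<rho> = evaluation a b c d s"
  have hom: "tetra.sl2_hom \<rho>"
    unfolding \<rho>_def using evaluation(1)[OF abcd s] .
  note D = tetra.sl2_homD[OF hom]
  have neq: "a \<noteq> b" "b \<noteq> a" "a \<noteq> c" "c \<noteq> a" "a \<noteq> d" "d \<noteq> a" "b \<noteq> c" "c \<noteq> b" "b \<noteq> d" "d \<noteq> b"
    "c \<noteq> d" "d \<noteq> c"
    using abcd by auto
  have \<rho>: "\<rho> (tet_x i j) = gen_image a b c d s i j" if "i \<noteq> j" for i j
    using evaluation(2)[OF abcd s that] by (simp add: \<rho>_def)
  note val = D \<rho> neq gen_image_simps[OF abcd]
  have A: "tetra.power_triples A" "A 0 = ?I" "fst (A 1) = tet_x d c + tet_x c a"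
    and B: "tetra.power_triples B" "B 0 = ?I" "fst (tetra.rot (B 1)) = tet_x d a + tet_x a b"
    and C: "tetra.power_triples C" "C 0 = ?I" "fst (tetra.rot (tetra.rot (C 1))) = tet_x d b + tet_x b c"
    using frame by (auto simp: tetra.frame_powers_def)
  have std: "\<rho> (fst ?I) = (1, 0, 0)" "\<rho> (fst (snd ?I)) = (0, 1, 0)" "\<rho> (snd (snd ?I)) = (0, 0, 1)"
    by (simp_all add: tetra.triple_def val)
  have mul: "tetra.mul (T 0) (T n) (T n)" if "tetra.power_triples T" for T :: "nat \<Rightarrow> 'f tet \<times> 'f tet \<times> 'f tet" and n
    using that by (rule tetra.power_triplesD) simp
  have eA: "tetra.eigentriple \<rho> s (A 0) (A 1)"
    by (rule tetra.eigentripleI[OF hom mul[OF A(1)] mul[OF A(1)]])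
      (unfold A, simp add: tetra.triple_def val sl2_scale_def)
  have rB: "tetra.power_triples (\<lambda>n. tetra.rot (B n))"
    using B(1) by (rule tetra.power_triples_rot)
  \<comment> \<open>The highest weight vector of \<open>B 1\<close> is known only in the rotated
    frame, so the eigenvalue is found there and carried back by two more rotations; \<open>C\<close>
    needs one.\<close>
  have "tetra.eigentriple \<rho> (1 - 1 / s) (tetra.rot (B 0)) (tetra.rot (B 1))"
    by (rule tetra.eigentripleI[OF hom mul[OF rB] mul[OF rB]])
      (unfold B tetra.rot_triple, simp add: tetra.triple_def val sl2_scale_def)
  from tetra.eigentriple_rot[OF hom tetra.eigentriple_rot[OF hom this]]
  have eB: "tetra.eigentriple \<rho> (1 - 1 / s) (B 0) (B 1)"
    by (simp add: tetra.rot_rot_rot)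
  have rC: "tetra.power_triples (\<lambda>n. tetra.rot (tetra.rot (C n)))"
    using C(1) by (intro tetra.power_triples_rot)
  have "tetra.eigentriple \<rho> (1 / (1 - s)) (tetra.rot (tetra.rot (C 0))) (tetra.rot (tetra.rot (C 1)))"
    by (rule tetra.eigentripleI[OF hom mul[OF rC] mul[OF rC]])
      (unfold C tetra.rot_triple, simp add: tetra.triple_def val sl2_scale_def)
  from tetra.eigentriple_rot[OF hom this]
  have eC: "tetra.eigentriple \<rho> (1 / (1 - s)) (C 0) (C 1)"
    by (simp add: tetra.rot_rot_rot)
  show "evaluation a b c d s (tetra.triple_comb A p q r) = (poly p s, poly q s, poly r s)"
    and "evaluation a b c d s (tetra.triple_comb B p q r)
      = (poly p (1 - 1 / s), poly q (1 - 1 / s), poly r (1 - 1 / s))"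
    and "evaluation a b c d s (tetra.triple_comb C p q r)
      = (poly p (1 / (1 - s)), poly q (1 / (1 - s)), poly r (1 / (1 - s)))"
    unfolding \<rho>_def[symmetric]
    using tetra.hom_triple_comb[OF hom A(1) eA, unfolded A(2), OF std]
      tetra.hom_triple_comb[OF hom B(1) eB, unfolded B(2), OF std]
      tetra.hom_triple_comb[OF hom C(1) eC, unfolded C(2), OF std] by auto
qed

text \<open>Partial fractions leave only constant coefficients with sum 0 in each coordinate, and
  these cancel because \<open>A\<close>, \<open>B\<close>, \<open>C\<close> have the same zeroth
  power.\<close>

lemma evaluation_eq_0:
  fixes w :: "'f::field_char_0 tet"
  assumes abcd: "distinct [a, b, c, d]"
    and zero: "\<And>s. s \<noteq> 0 \<Longrightarrow> s \<noteq> 1 \<Longrightarrow> evaluation a b c d s w = 0"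
  shows "w = 0"
proof -
  obtain A B C where frame: "tetra.frame_powers a b c d A B C"
    and "tetra.power_span A B C = (UNIV :: 'f tet set)"
    using tet_power_span[OF abcd] by blast
  then obtain p q r p' q' r' p'' q'' r''
    where w: "w = tetra.triple_comb A p q r + tetra.triple_comb B p' q' r' + tetra.triple_comb C p'' q'' r''"
    using tetra.power_span_triple_comb[of w A B C] by auto
  have "evaluation a b c d s w = (poly p s + poly p' (1 - 1 / s) + poly p'' (1 / (1 - s)),
      poly q s + poly q' (1 - 1 / s) + poly q'' (1 / (1 - s)),
      poly r s + poly r' (1 - 1 / s) + poly r'' (1 / (1 - s)))" if "s \<noteq> 0" "s \<noteq> 1" for s
    using that
    by (simp add: w tetra.sl2_homD[OF evaluation(1)[OF abcd that]] evaluation_triple_comb[OF abcd frame that])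
  with zero have "poly p s + poly p' (1 - 1 / s) + poly p'' (1 / (1 - s)) = 0"
      "poly q s + poly q' (1 - 1 / s) + poly q'' (1 / (1 - s)) = 0"
      "poly r s + poly r' (1 - 1 / s) + poly r'' (1 / (1 - s)) = 0" if "s \<noteq> 0" "s \<noteq> 1" for s
    using that by (auto simp: zero_prod_def)
  note const = partial_fractions_unique[OF this(1)] partial_fractions_unique[OF this(2)]
    partial_fractions_unique[OF this(3)]
  have 0: "A 0 = tetra.triple a b c" "B 0 = tetra.triple a b c" "C 0 = tetra.triple a b c"
    using frame by (auto simp: tetra.frame_powers_def)
  have *: "tet_scale x v + tet_scale y v + tet_scale z v = 0" if "x + y + z = 0" for x y z and v :: "'f tet"
    using that by (simp flip: tet.scale_left_distrib)
  obtain e h f :: "'f tet" where ehf: "tetra.triple a b c = (e, h, f)"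
    by (metis prod.exhaust)
  have "w = (tet_scale (coeff p 0) e + tet_scale (coeff p' 0) e + tet_scale (coeff p'' 0) e)
    + (tet_scale (coeff q 0) h + tet_scale (coeff q' 0) h + tet_scale (coeff q'' 0) h)
    + (tet_scale (coeff r 0) f + tet_scale (coeff r' 0) f + tet_scale (coeff r'' 0) f)"
    unfolding w tetra.triple_comb_def using const
    by (simp add: tetra.poly_comb_const 0 ehf algebra_simps)
  also have "\<dots> = 0"
    using const by (simp add: *)
  finally show ?thesis .
qed

lemma evaluation_eqI:
  fixes v w :: "'f::field_char_0 tet"
  assumes abcd: "distinct [a, b, c, d]"
    and "\<And>s. s \<noteq> 0 \<Longrightarrow> s \<noteq> 1 \<Longrightarrow> evaluation a b c d s v = evaluation a b c d s w"
  shows "v = w"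
  using evaluation_eq_0[OF abcd, of "v - w"] assms(2)
  by (simp add: tetra.sl2_homD[OF evaluation(1)[OF abcd]])

lemma evaluation_regular:
  fixes w :: "'f::field_char_0 tet"
  assumes abcd: "distinct [a, b, c, d]"
  obtains g1 g2 g3 where "regular g1" "regular g2" "regular g3"
    "\<And>s. s \<noteq> 0 \<Longrightarrow> s \<noteq> 1 \<Longrightarrow> evaluation a b c d s w = (g1 s, g2 s, g3 s)"
proof -
  obtain A B C where frame: "tetra.frame_powers a b c d A B C"
    and "tetra.power_span A B C = (UNIV :: 'f tet set)"
    using tet_power_span[OF abcd] by blast
  then obtain p q r p' q' r' p'' q'' r''
    where w: "w = tetra.triple_comb A p q r + tetra.triple_comb B p' q' r' + tetra.triple_comb C p'' q'' r''"
    using tetra.power_span_triple_comb[of w A B C] by auto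
  let ?g = "\<lambda>p p' p'' s. poly p s + poly p' (1 - 1 / s) + poly p'' (1 / (1 - s))"
  show ?thesis
  proof
    show "regular (?g p p' p'')" "regular (?g q q' q'')" "regular (?g r r' r'')"
      unfolding regular_def by blast+
    show "evaluation a b c d s w = (?g p p' p'' s, ?g q q' q'' s, ?g r r' r'' s)" if "s \<noteq> 0" "s \<noteq> 1" for s
      by (simp add: w tetra.sl2_homD[OF evaluation(1)[OF abcd that]] evaluation_triple_comb[OF abcd frame that])
  qed
qed

text \<open>With \<open>evaluation_regular\<close> and \<open>evaluation_eqI\<close>, elements of
  the algebra become the same as triples of regular functions away from 0 and 1.\<close>

lemma evaluation_surj:
  fixes g1 g2 g3 :: "'f::field_char_0 \<Rightarrow> 'f"
  assumes abcd: "distinct [a, b, c, d]" and g: "regular g1" "regular g2" "regular g3"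
  obtains w where "\<And>s. s \<noteq> 0 \<Longrightarrow> s \<noteq> 1 \<Longrightarrow> evaluation a b c d s w = (g1 s, g2 s, g3 s)"
proof -
  obtain A B C :: "nat \<Rightarrow> 'f tet \<times> 'f tet \<times> 'f tet" where frame: "tetra.frame_powers a b c d A B C"
    using tet_power_span[OF abcd] by blast
  obtain p q r p' q' r' p'' q'' r'' where
    "\<And>s. s \<noteq> 0 \<Longrightarrow> s \<noteq> 1 \<Longrightarrow> g1 s = poly p s + poly p' (1 - 1 / s) + poly p'' (1 / (1 - s))"
    "\<And>s. s \<noteq> 0 \<Longrightarrow> s \<noteq> 1 \<Longrightarrow> g2 s = poly q s + poly q' (1 - 1 / s) + poly q'' (1 / (1 - s))"
    "\<And>s. s \<noteq> 0 \<Longrightarrow> s \<noteq> 1 \<Longrightarrow> g3 s = poly r s + poly r' (1 - 1 / s) + poly r'' (1 / (1 - s))"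
    using g unfolding regular_def by metis
  then show ?thesis
    by (intro that[of "tetra.triple_comb A p q r + tetra.triple_comb B p' q' r' + tetra.triple_comb C p'' q'' r''"])
      (simp add: tetra.sl2_homD[OF evaluation(1)[OF abcd]] evaluation_triple_comb[OF abcd frame])
qed

text \<open>Commuting with \<open>x i j\<close> means commuting with its value at every
  \<open>s\<close>, a nonzero element of sl2, whose centralizer is a line. Conversely both defining
  conditions may be tested after evaluation. The factor \<open>k\<close> may depend on
  \<open>s\<close> in any way.\<close>

lemma tet_X_iff:
  fixes w :: "'f::field_char_0 tet"
  assumes abcd: "distinct [a, b, c, d]" and "i \<noteq> j"
  shows "w \<in> tet_X i j \<longleftrightarrow>
    (\<forall>s. s \<noteq> 0 \<longrightarrow> s \<noteq> 1 \<longrightarrow> (\<exists>k. evaluation a b c d s w = sl2_scale k (gen_image a b c d s i j)))"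
proof
  have img: "tetrahedron sl2_scale sl2_bracket (gen_image a b c d s)" if "s \<noteq> 0" "s \<noteq> 1" for s :: 'f
    using abcd that by (intro tetrahedron_gen_image index_UNIV) auto
  note D = tetra.sl2_homD[OF evaluation(1)[OF abcd]] evaluation(2)[OF abcd]
  show "\<forall>s. s \<noteq> 0 \<longrightarrow> s \<noteq> 1 \<longrightarrow> (\<exists>k. evaluation a b c d s w = sl2_scale k (gen_image a b c d s i j))"
    if "w \<in> tet_X i j"
  proof (intro allI impI)
    fix s :: 'f assume s: "s \<noteq> 0" "s \<noteq> 1"
    have "tet_bracket (tet_x i j) w = 0"
      using that by (simp add: tet_X_def tet_x_like_def)
    then have "sl2_bracket (gen_image a b c d s i j) (evaluation a b c d s w) = 0"
      using D(3)[OF s, of "tet_x i j" w] D(4)[OF s] D(7)[OF s \<open>i \<noteq> j\<close>] by simp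
    moreover have "sl2_disc (gen_image a b c d s i j) = 1"
      using abcd s \<open>i \<noteq> j\<close> by (intro sl2_disc_gen_image index_UNIV) auto
    then have "gen_image a b c d s i j \<noteq> 0"
      by (auto simp: sl2_disc_def zero_prod_def)
    ultimately show "\<exists>k. evaluation a b c d s w = sl2_scale k (gen_image a b c d s i j)"
      by (rule sl2_centralizer)
  qed
  show "w \<in> tet_X i j"
    if w: "\<forall>s. s \<noteq> 0 \<longrightarrow> s \<noteq> 1 \<longrightarrow> (\<exists>k. evaluation a b c d s w = sl2_scale k (gen_image a b c d s i j))"
  proof -
    have "tet_bracket (tet_x i j) w = 0"
    proof (rule evaluation_eq_0[OF abcd])
      fix s :: 'f assume s: "s \<noteq> 0" "s \<noteq> 1"
      then obtain k where "evaluation a b c d s w = sl2_scale k (gen_image a b c d s i j)"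
        using w by blast
      then show "evaluation a b c d s (tet_bracket (tet_x i j) w) = 0"
        using s \<open>i \<noteq> j\<close> by (simp add: D sl2.bracket_scale_right sl2.bracket_self)
    qed
    moreover have "tet_bracket (tet_x k h) (tet_bracket (tet_x k h) (tet_bracket (tet_x k h) w))
          = tet_scale 4 (tet_bracket (tet_x k h) w)" if "k \<noteq> h" for h k
    proof (rule evaluation_eqI[OF abcd])
      fix s :: 'f assume s: "s \<noteq> 0" "s \<noteq> 1"
      have "sl2_disc (gen_image a b c d s k h) = 1"
        using abcd s that by (intro sl2_disc_gen_image index_UNIV) auto
      then show "evaluation a b c d s (tet_bracket (tet_x k h) (tet_bracket (tet_x k h) (tet_bracket (tet_x k h) w)))
          = evaluation a b c d s (tet_scale 4 (tet_bracket (tet_x k h) w))"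
        using s that by (simp add: D sl2_cubic)
    qed
    ultimately show ?thesis
      by (auto simp: tet_X_def tet_x_like_def)
  qed
qed

theorem proposition4p5:
  fixes h i j k :: 4
  assumes "distinct [h, i, j, k]"
  shows "tet.direct_sum_of (UNIV :: 'f::field_char_0 tet set) [tet_X k h, tet_X h i, tet_X i j]"
proof -
  \<comment> \<open>Evaluating along the path \<open>k, h, i, j\<close> gives the three generators
    the values \<open>(0, -1, 1)\<close>, \<open>(0, 1, 0)\<close>, \<open>(1 - s, -1, 0)\<close>,
    which form a triangular system.\<close>
  have khij: "distinct [k, h, i, j]"
    using assms by auto
  have neq: "k \<noteq> h" "h \<noteq> i" "i \<noteq> j" using assms by auto
  note D = tetra.sl2_homD[OF evaluation(1)[OF khij]]
  note X_iff = tet_X_iff[OF khij neq(1)] tet_X_iff[OF khij neq(2)] tet_X_iff[OF khij neq(3)]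
  have zero: "u = 0 \<and> v = 0 \<and> w = 0"
    if X: "u \<in> tet_X k h" "v \<in> tet_X h i" "w \<in> tet_X i j" and sum: "u + v + w = 0" for u v w :: "'f tet"
  proof -
    have "evaluation k h i j s u = 0 \<and> evaluation k h i j s v = 0 \<and> evaluation k h i j s w = 0"
      if s: "s \<noteq> 0" "s \<noteq> 1" for s
    proof -
      obtain p q r where ev: "evaluation k h i j s u = sl2_scale p (0, - 1, 1)"
        "evaluation k h i j s v = sl2_scale q (0, 1, 0)"
        "evaluation k h i j s w = sl2_scale r (1 - s, - 1, 0)"
        using X s unfolding X_iff gen_image_simps[OF khij] by blast
      have "evaluation k h i j s u + evaluation k h i j s v + evaluation k h i j s w = 0"
        using arg_cong[OF sum, of "evaluation k h i j s"] by (simp add: D[OF s])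
      then have "r = 0" "p = 0" "q = 0"
        using s by (auto simp: ev sl2_scale_def zero_prod_def)
      then show ?thesis
        by (simp add: ev)
    qed
    then show ?thesis
      using evaluation_eq_0[OF khij] by blast
  qed
  have decomp: "\<exists>u\<in>tet_X k h. \<exists>v\<in>tet_X h i. \<exists>t\<in>tet_X i j. w = u + v + t" for w :: "'f tet"
  proof -
    obtain g1 g2 g3 where g: "regular g1" "regular g2" "regular g3"
      and w: "\<And>s. s \<noteq> 0 \<Longrightarrow> s \<noteq> 1 \<Longrightarrow> evaluation k h i j s w = (g1 s, g2 s, g3 s)"
      using evaluation_regular[OF khij] by metis
    \<comment> \<open>Only \<open>x i j\<close> has a first coordinate, namely \<open>1 - s\<close>,
      so its coefficient is \<open>g\<close>; only \<open>x k h\<close> has a third one, so its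
      coefficient is \<open>g3\<close>. The middle coordinate then forces \<open>g2 + g3 + g\<close>
      for \<open>x h i\<close>.\<close>
    define g where "g s = 1 / (1 - s) * g1 s" for s
    have "regular g"
      unfolding g_def using g(1) by (rule regular_mult_inverse)
    have zero_regular: "regular (\<lambda>s::'f. 0)"
      by (rule regularI[of _ 0 0 0]) simp
    obtain u where u: "\<And>s. s \<noteq> 0 \<Longrightarrow> s \<noteq> 1 \<Longrightarrow> evaluation k h i j s u = (0, - g3 s, g3 s)"
      using evaluation_surj[OF khij zero_regular regular_uminus[OF g(3)] g(3)] by metis
    obtain v where v: "\<And>s. s \<noteq> 0 \<Longrightarrow> s \<noteq> 1 \<Longrightarrow> evaluation k h i j s v = (0, g2 s + g3 s + g s, 0)"
      using evaluation_surj[OF khij zero_regular regular_add[OF regular_add[OF g(2,3)] \<open>regular g\<close>] zero_regular]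
      by metis
    obtain t where t: "\<And>s. s \<noteq> 0 \<Longrightarrow> s \<noteq> 1 \<Longrightarrow> evaluation k h i j s t = (g1 s, - g s, 0)"
      using evaluation_surj[OF khij g(1) regular_uminus[OF \<open>regular g\<close>] zero_regular] by metis
    have "w = u + v + t"
      by (rule evaluation_eqI[OF khij]) (simp add: D u v t w)
    moreover have "u \<in> tet_X k h"
      unfolding X_iff gen_image_simps[OF khij]
      by (intro allI impI, rule_tac x = "g3 s" in exI) (simp add: u sl2_scale_def)
    moreover have "v \<in> tet_X h i"
      unfolding X_iff gen_image_simps[OF khij]
      by (intro allI impI, rule_tac x = "g2 s + g3 s + g s" in exI) (simp add: v sl2_scale_def)
    moreover have "t \<in> tet_X i j"
      unfolding X_iff gen_image_simps[OF khij]
      by (intro allI impI, rule_tac x = "g s" in exI) (simp add: t sl2_scale_def g_def)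
    ultimately show ?thesis by blast
  qed
  have listset: "listset [tet_X k h, tet_X h i, tet_X i j]
      = {[u, v, w] |u v w. u \<in> tet_X k h \<and> v \<in> tet_X h i \<and> w \<in> (tet_X i j :: 'f tet set)}"
    by (auto simp: set_Cons_def)
  have "bij_betw sum_list (listset [tet_X k h, tet_X h i, tet_X i j]) (UNIV :: 'f tet set)"
    unfolding bij_betw_def
  proof
    show "inj_on sum_list (listset [tet_X k h, tet_X h i, tet_X i j :: 'f tet set])"
    proof (rule inj_onI)
      fix us vs :: "'f tet list"
      assume "us \<in> listset [tet_X k h, tet_X h i, tet_X i j]" "vs \<in> listset [tet_X k h, tet_X h i, tet_X i j]"
        and sum: "sum_list us = sum_list vs"
      then obtain u v w u' v' w' where eq: "us = [u, v, w]" "vs = [u', v', w']"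
        and X: "u \<in> tet_X k h" "v \<in> tet_X h i" "w \<in> tet_X i j" "u' \<in> tet_X k h" "v' \<in> tet_X h i" "w' \<in> tet_X i j"
        unfolding listset by blast
      have "(u - u') + (v - v') + (w - w') = 0"
        using sum by (simp add: eq algebra_simps)
      then show "us = vs"
        using zero[of "u - u'" "v - v'" "w - w'"] X by (simp add: eq tet.subspace_diff subspace_tet_X)
    qed
    show "sum_list ` listset [tet_X k h, tet_X h i, tet_X i j] = (UNIV :: 'f tet set)"
    proof (intro set_eqI iffI UNIV_I)
      fix w :: "'f tet"
      obtain u v t where "u \<in> tet_X k h" "v \<in> tet_X h i" "t \<in> tet_X i j" "w = u + v + t"
        using decomp by blast
      then show "w \<in> sum_list ` listset [tet_X k h, tet_X h i, tet_X i j]"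
        unfolding listset by (intro image_eqI[of _ _ "[u, v, t]"]) (auto simp: add.assoc)
    qed
  qed
  then show ?thesis
    by (auto simp: tet.direct_sum_of_def subspace_tet_X)
qed

end
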